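(* Let $K=\mathbb{Q}(\sqrt{p},\sqrt{q})$ be a real biquadratic field, where $p,q>1$ are distinct squarefree integers, and let $\mathcal{O}_K$ be its ring of integers. Then there does not exist a $\mathbb{Z}$-form that is universal over $\mathcal{O}_K$.
   Context: A $\mathbb{Z}$-form is a positive definite quadratic form $Q(x_1,\dots,x_r)=\sum_{1\le i\le j\le r}a_{ij}x_ix_j$ with all $a_{ij}\in\mathbb{Z}$. An element of $\mathcal{O}_K$ is totally positive if its image under each of the four real embeddings of $K$ is positive. A $\mathbb{Z}$-form $Q$ is universal over $\mathcal{O}_K$ if every totally positive $\alpha\in\mathcal{O}_K$ equals $Q(v)$ for some $v\in\mathcal{O}_K^r$. *)

theory Defs
  imports Complex_Main "HOL-Computational_Algebra.Polynomial" "HOL-Computational_Algebra.Squarefree"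
begin

definition biquad_field :: "int \<Rightarrow> int \<Rightarrow> real set" where
  "biquad_field p q = {x. \<exists>a b c d :: rat.
     x = of_rat a + of_rat b * sqrt (of_int p) + of_rat c * sqrt (of_int q)
         + of_rat d * sqrt (of_int p) * sqrt (of_int q)}"

definition ring_of_integers :: "int \<Rightarrow> int \<Rightarrow> real set" where
  "ring_of_integers p q = {x \<in> biquad_field p q. algebraic_int x}"

definition real_embedding :: "int \<Rightarrow> int \<Rightarrow> (real \<Rightarrow> real) \<Rightarrow> bool" where
  "real_embedding p q \<sigma> \<longleftrightarrow> \<sigma> 1 = 1 \<and>
     (\<forall>x\<in>biquad_field p q. \<forall>y\<in>biquad_field p q.
        \<sigma> (x + y) = \<sigma> x + \<sigma> y \<and> \<sigma> (x * y) = \<sigma> x * \<sigma> y)"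

definition totally_positive :: "int \<Rightarrow> int \<Rightarrow> real \<Rightarrow> bool" where
  "totally_positive p q \<alpha> \<longleftrightarrow> (\<forall>\<sigma>. real_embedding p q \<sigma> \<longrightarrow> \<sigma> \<alpha> > 0)"

definition qform :: "nat \<Rightarrow> (nat \<Rightarrow> nat \<Rightarrow> int) \<Rightarrow> (nat \<Rightarrow> real) \<Rightarrow> real" where
  "qform r a v = (\<Sum>i<r. \<Sum>j<r. if i \<le> j then of_int (a i j) * v i * v j else 0)"

definition Z_form :: "nat \<Rightarrow> (nat \<Rightarrow> nat \<Rightarrow> int) \<Rightarrow> bool" where
  "Z_form r a \<longleftrightarrow> (\<forall>v :: nat \<Rightarrow> real. (\<exists>i<r. v i \<noteq> 0) \<longrightarrow> qform r a v > 0)"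

definition universal_over :: "int \<Rightarrow> int \<Rightarrow> nat \<Rightarrow> (nat \<Rightarrow> nat \<Rightarrow> int) \<Rightarrow> bool" where
  "universal_over p q r a \<longleftrightarrow>
     (\<forall>\<alpha>\<in>ring_of_integers p q. totally_positive p q \<alpha> \<longrightarrow>
        (\<exists>v. (\<forall>i<r. v i \<in> ring_of_integers p q) \<and> qform r a v = \<alpha>))"

end

(* Write p and q as products of two of the pairwise coprime squarefree integers g < e < f, so that
   K is spanned over the rationals by 1, sqrt(ef), sqrt(ge), sqrt(gf).  If a Z-form Q represents
   alpha = Q(v), expand v = (a + b sqrt(ef) + c sqrt(ge) + d sqrt(gf)) / k with integral vectors
   a, b, c, d.  Comparing rational parts gives
     k^2 Tr(alpha) / 4 = Q(a) + ef Q(b) + ge Q(c) + gf Q(d),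
   where every nonzero vector contributes at least 1 to its Q, and an even one at least 4.  Take for
   alpha a totally positive element of least trace with irrational part sqrt(gf) (or sqrt(gf) / 2
   if gf = 1 mod 4), where sqrt(gf) is the middle one of the three square roots.  The trace is then
   so small that b = 0 or d = 0, which together with the parities of the coordinates of integral elements of
   K is incompatible with the coefficient of sqrt(gf), namely B(a,d) + e B(b,c).  The fields
   Q(sqrt 2, sqrt 5), Q(sqrt 3, sqrt 5) and Q(sqrt 2, sqrt 3) escape this argument, because Q(sqrt 5)
   has universal Z-forms and 2 + sqrt 3 = ((sqrt 2 + sqrt 6) / 2)^2; there 2 + sqrt 2, 2 + sqrt 3
   and 3 + sqrt 6 are not represented. *)

theory Submission
  imports Defs "Jordan_Normal_Form.Char_Poly"
begin

section \<open>Sums and products of algebraic integers\<close>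

text \<open>Integrality enters only through relative traces and norms to the three quadratic
  subfields: they yield necessary parities, and the ring of integers is never determined. The
  parities depend on ef, ge, gf mod 4. If two of these are 1 mod 4, so is the third; hence all,
  exactly one or none of them are. The denominator k is 4 in the first case and 2 in the others. A
  parity either makes a vector even or links it to a partner, which becomes even once the first
  vector vanishes; a nonzero even vector costs four times as much. The weighted sum of Q-values is a
  budget, for k = 2 about 4 sqrt(gf), or half of that if gf = 1 mod 4. The coefficient of sqrt(gf)
  must come from the pair (a,d) or from (b,c). If b is too dear, at price ef > gf, then (a,d) must
  supply it and the parities make that pair too dear as well. If d is too dear, then (b,c) must
  supply it, at price ef + ge >= 2e sqrt(gf) by the inequality of arithmetic and geometric means.
  The constants in the hypotheses mark where these estimates start to hold.\<close>

definition int_span :: "nat \<Rightarrow> (nat \<Rightarrow> real) \<Rightarrow> real set" where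
  "int_span N b = {\<Sum>l<N. of_int (m l) * b l |m. True}"

lemma int_span_base: "k < N \<Longrightarrow> b k \<in> int_span N b"
  unfolding int_span_def
  by (rule CollectI, rule exI[of _ "\<lambda>l. if l = k then 1 else 0"])
     (simp add: if_distrib[of real_of_int] if_distrib[of "\<lambda>c. c * _"] cong: if_cong)

lemma int_span_add: "u \<in> int_span N b \<Longrightarrow> w \<in> int_span N b \<Longrightarrow> u + w \<in> int_span N b"
proof -
  assume "u \<in> int_span N b" "w \<in> int_span N b"
  then obtain m n where "u = (\<Sum>l<N. of_int (m l) * b l)" "w = (\<Sum>l<N. of_int (n l) * b l)"
    by (auto simp: int_span_def)
  then have "u + w = (\<Sum>l<N. of_int (m l + n l) * b l)"
    by (simp add: sum.distrib algebra_simps)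
  then show ?thesis unfolding int_span_def by (intro CollectI exI[of _ "\<lambda>l. m l + n l"]) simp
qed

lemma int_span_scale: "u \<in> int_span N b \<Longrightarrow> of_int c * u \<in> int_span N b"
proof -
  assume "u \<in> int_span N b"
  then obtain m where "u = (\<Sum>l<N. of_int (m l) * b l)"
    by (auto simp: int_span_def)
  then have "of_int c * u = (\<Sum>l<N. of_int (c * m l) * b l)"
    by (simp add: sum_distrib_left algebra_simps)
  then show ?thesis unfolding int_span_def by (intro CollectI exI[of _ "\<lambda>l. c * m l"]) simp
qed

lemma int_span_sum:
  "(\<And>i. i \<in> I \<Longrightarrow> h i \<in> int_span N b) \<Longrightarrow> (\<Sum>i\<in>I. h i) \<in> int_span N b"
proof (induction I rule: infinite_finite_induct)
  case (insert i I)
  then show ?case by (simp add: int_span_add)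
next
  case (infinite I)
  then show ?case by (auto simp: int_span_def intro!: exI[of _ "\<lambda>_. 0"])
next
  case empty
  then show ?case by (auto simp: int_span_def intro!: exI[of _ "\<lambda>_. 0"])
qed

lemma int_span_mult_closed:
  assumes "\<And>k. k < N \<Longrightarrow> z * b k \<in> int_span N b" and "u \<in> int_span N b"
  shows "z * u \<in> int_span N b"
proof -
  obtain m where u: "u = (\<Sum>l<N. of_int (m l) * b l)"
    using assms(2) by (auto simp: int_span_def)
  have "z * u = (\<Sum>l<N. of_int (m l) * (z * b l))"
    by (simp add: u sum_distrib_left mult_ac)
  also have "\<dots> \<in> int_span N b"
    by (intro int_span_sum int_span_scale assms(1)) simp
  finally show ?thesis .
qed

text \<open>z is an eigenvalue of the integer matrix describing multiplication by z.\<close>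

lemma algebraic_int_if_stable_span:
  assumes stable: "\<And>k. k < N \<Longrightarrow> z * b k \<in> int_span N b" and k0: "k0 < N" "b k0 \<noteq> 0"
  shows "algebraic_int z"
proof -
  have "\<exists>m. z * b k = (\<Sum>l<N. of_int (m l) * b l)" if "k < N" for k
    using stable[OF that] by (auto simp: int_span_def)
  then obtain M where M: "\<And>k. k < N \<Longrightarrow> z * b k = (\<Sum>l<N. real_of_int (M k l) * b l)"
    by metis
  define A where "A = mat N N (\<lambda>(i, j). M i j)"
  define A' where "A' = map_mat real_of_int A"
  have A: "A \<in> carrier_mat N N" and A': "A' \<in> carrier_mat N N"
    by (simp_all add: A_def A'_def)
  have "eigenvector A' (vec N b) z"
  proof -
    have "vec N b \<noteq> 0\<^sub>v N"
      using k0 by (metis index_vec index_zero_vec(1))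
    moreover have "A' *\<^sub>v vec N b = z \<cdot>\<^sub>v vec N b"
    proof (rule eq_vecI)
      fix i assume "i < dim_vec (z \<cdot>\<^sub>v vec N b)"
      then have i: "i < N" by simp
      then show "(A' *\<^sub>v vec N b) $ i = (z \<cdot>\<^sub>v vec N b) $ i"
        using M[OF i] by (simp add: A'_def A_def scalar_prod_def atLeast0LessThan)
    qed (simp add: A'_def A_def)
    ultimately show ?thesis using A' by (auto simp: eigenvector_def)
  qed
  then have "poly (char_poly A') z = 0"
    using eigenvalue_root_char_poly[OF A'] by (auto simp: eigenvalue_def)
  moreover have "char_poly A' = map_poly of_int (char_poly A)"
    unfolding A'_def by (rule of_int_hom.char_poly_hom[OF A])
  moreover have "lead_coeff (char_poly A) = 1"
    using degree_monic_char_poly[OF A] by simp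
  ultimately show ?thesis
    by (auto simp: algebraic_int_altdef_ipoly)
qed

text \<open>The monic equation of degree n writes \<open>x ^ n\<close> through lower powers, so the
  powers below n span a module stable under x. Positivity of n puts the nonzero element 1 among the
  generators.\<close>

lemma algebraic_int_powers:
  assumes "algebraic_int (x :: real)"
  obtains n where "n > 0" "\<And>i. i < n \<Longrightarrow> x * x ^ i \<in> int_span n (\<lambda>l. x ^ l)"
proof -
  obtain P where P: "poly (map_poly real_of_int P) x = 0" "lead_coeff P = 1"
    using assms by (auto simp: algebraic_int_altdef_ipoly)
  define n where "n = degree P"
  have "n > 0"
  proof (rule ccontr)
    assume "\<not> n > 0"
    then obtain c where "P = [:c:]" by (metis degree_eq_zeroE gr0I n_def)
    with P show False by simp
  qed
  have "0 = (\<Sum>i\<le>n. of_int (coeff P i) * x ^ i)"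
    using P(1) by (simp add: poly_altdef degree_map_poly coeff_map_poly n_def)
  also have "\<dots> = (\<Sum>i<n. of_int (coeff P i) * x ^ i) + x ^ n"
    using P(2) by (simp add: lessThan_Suc_atMost[symmetric] n_def)
  finally have "x ^ n = (\<Sum>i<n. of_int (- coeff P i) * x ^ i)"
    by (simp add: sum_negf)
  then have top: "x ^ n \<in> int_span n (\<lambda>l. x ^ l)"
    unfolding int_span_def by (intro CollectI exI[of _ "\<lambda>i. - coeff P i"]) simp
  have "x * x ^ i \<in> int_span n (\<lambda>l. x ^ l)" if "i < n" for i
  proof (cases "Suc i = n")
    case True
    then show ?thesis using top by auto
  next
    case False
    then show ?thesis
      using int_span_base[of "Suc i" n "\<lambda>l. x ^ l"] that by simp
  qed
  with \<open>n > 0\<close> show ?thesis by (rule that)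
qed

text \<open>The products \<open>x ^ i * y ^ j\<close> with i < n, j < m span one module stable under
  both x and y, hence under their sum and product.\<close>

lemma algebraic_int_add_mult:
  assumes "algebraic_int (x :: real)" "algebraic_int (y :: real)"
  shows "algebraic_int (x + y)" "algebraic_int (x * y)"
proof -
  obtain n where n: "n > 0" "\<And>i. i < n \<Longrightarrow> x * x ^ i \<in> int_span n (\<lambda>l. x ^ l)"
    using algebraic_int_powers[OF assms(1)] by metis
  obtain m where m: "m > 0" "\<And>i. i < m \<Longrightarrow> y * y ^ i \<in> int_span m (\<lambda>l. y ^ l)"
    using algebraic_int_powers[OF assms(2)] by metis
  \<comment> \<open>The pair (i, j) is coded as the single index i * m + j.\<close>
  define b where "b = (\<lambda>k. x ^ (k div m) * y ^ (k mod m))"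
  define N where "N = n * m"
  have b_in: "x ^ i * y ^ j \<in> int_span N b" if "i < n" "j < m" for i j
  proof -
    have "i * m + j < N"
      using that unfolding N_def
      by (metis add_less_cancel_left less_le_trans mult.commute mult_Suc mult_le_mono2 Suc_leI add.commute)
    moreover have "b (i * m + j) = x ^ i * y ^ j"
      using that by (simp add: b_def)
    ultimately show ?thesis using int_span_base by metis
  qed
  have x_st: "x * b k \<in> int_span N b" if "k < N" for k
  proof -
    have k: "k div m < n" "k mod m < m"
      using that m(1) by (simp_all add: N_def less_mult_imp_div_less)
    obtain c where "x * x ^ (k div m) = (\<Sum>l<n. of_int (c l) * x ^ l)"
      using n(2)[OF k(1)] by (auto simp: int_span_def)
    then have "x * b k = (\<Sum>l<n. of_int (c l) * (x ^ l * y ^ (k mod m)))"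
      by (simp add: b_def mult.assoc[symmetric] sum_distrib_right)
    also have "\<dots> \<in> int_span N b"
      using k by (intro int_span_sum int_span_scale b_in) auto
    finally show ?thesis .
  qed
  have y_st: "y * b k \<in> int_span N b" if "k < N" for k
  proof -
    have k: "k div m < n" "k mod m < m"
      using that m(1) by (simp_all add: N_def less_mult_imp_div_less)
    obtain c where c: "y * y ^ (k mod m) = (\<Sum>l<m. of_int (c l) * y ^ l)"
      using m(2)[OF k(2)] by (auto simp: int_span_def)
    have "y * b k = x ^ (k div m) * (y * y ^ (k mod m))" by (simp add: b_def mult_ac)
    also have "\<dots> = (\<Sum>l<m. of_int (c l) * (x ^ (k div m) * y ^ l))"
      by (simp add: c sum_distrib_left mult_ac)
    also have "\<dots> \<in> int_span N b"
      using k by (intro int_span_sum int_span_scale b_in) auto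
    finally show ?thesis .
  qed
  have b0: "0 < N" "b 0 \<noteq> 0"
    using n(1) m(1) by (simp_all add: N_def b_def)
  show "algebraic_int (x + y)"
    by (rule algebraic_int_if_stable_span[where b = b, OF _ b0])
       (simp add: distrib_right int_span_add x_st y_st)
  show "algebraic_int (x * y)"
    by (rule algebraic_int_if_stable_span[where b = b, OF _ b0])
       (simp add: mult.assoc int_span_mult_closed[of N x b] x_st y_st)
qed

section \<open>Elements of a biquadratic field\<close>

text \<open>In lowest terms the square of the denominator must divide P.\<close>

lemma squarefree_mult_square_int:
  fixes P :: int and r :: real
  assumes "squarefree P" "r \<in> \<rat>" "of_int P * r\<^sup>2 \<in> \<int>"
  shows "r \<in> \<int>"
proof -
  obtain u w where r: "r = of_int u / of_int w" and w: "w > 0" and cop: "coprime u w"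
    using assms(2) by (rule Rats_cases')
  obtain k where "of_int P * r\<^sup>2 = of_int k"
    using assms(3) by (auto elim: Ints_cases)
  then have "real_of_int (P * u\<^sup>2) = of_int (k * w\<^sup>2)"
    using w by (simp add: r field_simps)
  then have "P * u\<^sup>2 = k * w\<^sup>2"
    by linarith
  then have "w\<^sup>2 dvd P * u\<^sup>2" by simp
  moreover have "coprime (w\<^sup>2) (u\<^sup>2)"
    using cop by (simp add: coprime_commute)
  ultimately have "w\<^sup>2 dvd P"
    using coprime_dvd_mult_left_iff by blast
  then have "w dvd 1"
    using assms(1) squarefreeD by blast
  with w have "w = 1" by auto
  then show ?thesis by (simp add: r)
qed

text \<open>If s were rational, the preceding lemma applied to 1/s would make it an integer, since P
  (1/s)^2 = 1; then P would divide 1.\<close>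

lemma squarefree_surd_irrational:
  fixes P :: int and s :: real
  assumes "squarefree P" "P > 1" "s\<^sup>2 = of_int P"
  shows "s \<notin> \<rat>"
proof
  assume "s \<in> \<rat>"
  have "s \<noteq> 0" using assms by auto
  then have "of_int P * (1 / s)\<^sup>2 = 1"
    by (simp add: assms(3)[symmetric] power_divide)
  then have "1 / s \<in> \<int>"
    using squarefree_mult_square_int[OF assms(1), of "1 / s"] \<open>s \<in> \<rat>\<close> by simp
  then obtain k where "1 / s = of_int k" by (auto elim: Ints_cases)
  then have "of_int P * (real_of_int k)\<^sup>2 = 1"
    using \<open>of_int P * (1 / s)\<^sup>2 = 1\<close> by simp
  then have "P * k\<^sup>2 = 1"
    by (metis of_int_1 of_int_eq_iff of_int_mult of_int_power)
  then show False
    using assms(2) by (auto simp: zmult_eq_1_iff)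
qed

lemma irrational_pair_zero:
  fixes s :: real
  assumes "s \<notin> \<rat>" "A \<in> \<rat>" "B \<in> \<rat>" "A + B * s = 0"
  shows "A = 0" "B = 0"
proof -
  show "B = 0"
  proof (rule ccontr)
    assume "B \<noteq> 0"
    then have "s = - A / B" using assms(4) by (simp add: field_simps)
    with assms show False by simp
  qed
  with assms(4) show "A = 0" by simp
qed

text \<open>The arguments x, y, z stand for any choice of signs of the square roots of g, e, f; the
  conjugates of an element arise by changing these signs. Products of two of them are used
  instead of sqrt(ef), sqrt(ge), sqrt(gf), so that cyclic rotation of (g, e, f) is a symmetry.\<close>

definition surd :: "real \<Rightarrow> real \<Rightarrow> real \<Rightarrow> real \<Rightarrow> real \<Rightarrow> real \<Rightarrow> real \<Rightarrow> real" where
  "surd a b c d x y z = a + b * (y * z) + c * (x * y) + d * (x * z)"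

lemma surd_rotate: "surd a b c d x y z = surd a c d b z x y"
  by (simp add: surd_def algebra_simps)

lemma surd_swap: "surd a b c d x y z = surd a b d c x z y"
  by (simp add: surd_def algebra_simps)

lemma surd_add:
  "surd a b c d x y z + surd a' b' c' d' x y z = surd (a + a') (b + b') (c + c') (d + d') x y z"
  by (simp add: surd_def algebra_simps)

lemma surd_mult:
  fixes g e f :: real
  assumes "x\<^sup>2 = g" "y\<^sup>2 = e" "z\<^sup>2 = f"
  shows "surd a b c d x y z * surd a' b' c' d' x y z =
    surd (a * a' + e * f * b * b' + g * e * c * c' + g * f * d * d')
         (a * b' + b * a' + g * (c * d' + d * c'))
         (a * c' + c * a' + f * (b * d' + d * b'))
         (a * d' + d * a' + e * (b * c' + c * b')) x y z"
  unfolding surd_def assms[symmetric] by (simp add: power2_eq_square algebra_simps)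

text \<open>The order of the quantifiers is the point: the same rational coefficients serve every
  choice of signs of the roots, so polynomial equations pass to conjugates without a construction of
  automorphisms.\<close>

lemma poly_surd:
  fixes g e f :: real
  assumes "g \<in> \<rat>" "e \<in> \<rat>" "f \<in> \<rat>" "a \<in> \<rat>" "b \<in> \<rat>" "c \<in> \<rat>" "d \<in> \<rat>"
  shows "\<exists>a'\<in>\<rat>. \<exists>b'\<in>\<rat>. \<exists>c'\<in>\<rat>. \<exists>d'\<in>\<rat>. \<forall>x y z.
    x\<^sup>2 = g \<longrightarrow> y\<^sup>2 = e \<longrightarrow> z\<^sup>2 = f \<longrightarrow>
    poly (map_poly of_int P) (surd a b c d x y z) = surd a' b' c' d' x y z"
proof (induction P)
  case 0
  show ?case by (rule bexI[of _ 0])+ (auto simp: surd_def)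
next
  case (pCons p P)
  then obtain a' b' c' d' where rat: "a' \<in> \<rat>" "b' \<in> \<rat>" "c' \<in> \<rat>" "d' \<in> \<rat>"
    and IH: "\<And>x y z. x\<^sup>2 = g \<Longrightarrow> y\<^sup>2 = e \<Longrightarrow> z\<^sup>2 = f \<Longrightarrow>
      poly (map_poly of_int P) (surd a b c d x y z) = surd a' b' c' d' x y z"
    by blast
  have *: "poly (map_poly of_int (pCons p P)) (surd a b c d x y z) =
      surd (p + (a * a' + e * f * b * b' + g * e * c * c' + g * f * d * d'))
         (a * b' + b * a' + g * (c * d' + d * c'))
         (a * c' + c * a' + f * (b * d' + d * b'))
         (a * d' + d * a' + e * (b * c' + c * b')) x y z"
    if "x\<^sup>2 = g" "y\<^sup>2 = e" "z\<^sup>2 = f" for x y z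
  proof -
    have "poly (map_poly of_int (pCons p P)) (surd a b c d x y z) =
        surd p 0 0 0 x y z + surd a b c d x y z * surd a' b' c' d' x y z"
      using IH[OF that] by (simp add: Polynomial.map_poly_pCons surd_def)
    then show ?thesis
      by (simp add: surd_mult[OF that] surd_add)
  qed
  have "p + (a * a' + e * f * b * b' + g * e * c * c' + g * f * d * d') \<in> \<rat>"
    "a * b' + b * a' + g * (c * d' + d * c') \<in> \<rat>"
    "a * c' + c * a' + f * (b * d' + d * b') \<in> \<rat>"
    "a * d' + d * a' + e * (b * c' + c * b') \<in> \<rat>"
    using assms rat by simp_all
  with * show ?case by blast
qed

text \<open>Squarefree products encode at once that g, e, f are squarefree and pairwise coprime;
  \<open>nontriv\<close> says that no two of them equal 1. All conditions are symmetric in g, e,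
  f.\<close>

locale surd_triple =
  fixes g e f :: int
  assumes pos: "g > 0" "e > 0" "f > 0"
    and squarefree: "squarefree (e * f)" "squarefree (g * e)" "squarefree (g * f)"
    and nontriv: "e * f > 1" "g * e > 1" "g * f > 1"
begin

lemma rotate: "surd_triple f g e"
  using pos squarefree nontriv by unfold_locales (simp_all add: mult.commute)

lemma swap: "surd_triple g f e"
  using pos squarefree nontriv by unfold_locales (simp_all add: mult.commute)

text \<open>Multiplying by the conjugate over each quadratic subfield gives a relation between 1 and
  a single irrational root, whose rational part must vanish.\<close>

lemma surd_eq_0:
  assumes xyz: "x\<^sup>2 = of_int g" "y\<^sup>2 = of_int e" "z\<^sup>2 = of_int f"
    and rat: "a \<in> \<rat>" "b \<in> \<rat>" "c \<in> \<rat>" "d \<in> \<rat>"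
    and 0: "surd a b c d x y z = 0"
  shows "a = 0 \<and> b = 0 \<and> c = 0 \<and> d = 0"
proof -
  have ir: "y * z \<notin> \<rat>" "x * y \<notin> \<rat>" "x * z \<notin> \<rat>"
    using squarefree nontriv squarefree_surd_irrational[of "e * f" "y * z"]
      squarefree_surd_irrational[of "g * e" "x * y"] squarefree_surd_irrational[of "g * f" "x * z"]
    by (simp_all add: power_mult_distrib xyz)
  have "a\<^sup>2 + of_int e * of_int f * b\<^sup>2 - of_int g * (of_int e * c\<^sup>2 + of_int f * d\<^sup>2) + (2 * a * b - 2 * of_int g * c * d) * (y * z) = 0"
    using arg_cong[OF 0, of "\<lambda>t. t * surd a b (- c) (- d) x y z"]
    by (simp add: surd_def xyz[symmetric] power2_eq_square algebra_simps)
  then have 1: "a\<^sup>2 + of_int e * of_int f * b\<^sup>2 - of_int g * (of_int e * c\<^sup>2 + of_int f * d\<^sup>2) = 0"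
    by (rule irrational_pair_zero(1)[OF ir(1), rotated 2]) (use rat in auto)
  have "a\<^sup>2 + of_int g * of_int e * c\<^sup>2 - of_int f * (of_int e * b\<^sup>2 + of_int g * d\<^sup>2) + (2 * a * c - 2 * of_int f * b * d) * (x * y) = 0"
    using arg_cong[OF 0, of "\<lambda>t. t * surd a (- b) c (- d) x y z"]
    by (simp add: surd_def xyz[symmetric] power2_eq_square algebra_simps)
  then have 2: "a\<^sup>2 + of_int g * of_int e * c\<^sup>2 - of_int f * (of_int e * b\<^sup>2 + of_int g * d\<^sup>2) = 0"
    by (rule irrational_pair_zero(1)[OF ir(2), rotated 2]) (use rat in auto)
  have "a\<^sup>2 + of_int g * of_int f * d\<^sup>2 - of_int e * (of_int f * b\<^sup>2 + of_int g * c\<^sup>2) + (2 * a * d - 2 * of_int e * b * c) * (x * z) = 0"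
    using arg_cong[OF 0, of "\<lambda>t. t * surd a (- b) (- c) d x y z"]
    by (simp add: surd_def xyz[symmetric] power2_eq_square algebra_simps)
  then have 3: "a\<^sup>2 + of_int g * of_int f * d\<^sup>2 - of_int e * (of_int f * b\<^sup>2 + of_int g * c\<^sup>2) = 0"
    by (rule irrational_pair_zero(1)[OF ir(3), rotated 2]) (use rat in auto)
  have root: "t = 0" if "a\<^sup>2 = (t * s)\<^sup>2" "t \<in> \<rat>" "s \<notin> \<rat>" for s t
  proof -
    have "a + t * s = 0 \<or> - a + t * s = 0"
      using that(1) by (auto simp: power2_eq_iff)
    then show ?thesis
      using irrational_pair_zero(2)[OF that(3) _ that(2)] rat(1) Rats_minus_iff by blast
  qed
  \<comment> \<open>Adding the three norm equations in pairs cancels all but two squares.\<close>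
  have "a\<^sup>2 = (d * (x * z))\<^sup>2" "a\<^sup>2 = (c * (x * y))\<^sup>2" "a\<^sup>2 = (b * (y * z))\<^sup>2"
    using 1 2 3 by (simp_all add: power_mult_distrib xyz algebra_simps)
  then have "b = 0" "c = 0" "d = 0"
    using root rat ir by blast+
  with 0 show ?thesis by (simp add: surd_def)
qed

lemma surd_inject:
  assumes xyz: "x\<^sup>2 = of_int g" "y\<^sup>2 = of_int e" "z\<^sup>2 = of_int f"
    and rat: "a \<in> \<rat>" "b \<in> \<rat>" "c \<in> \<rat>" "d \<in> \<rat>" "a' \<in> \<rat>" "b' \<in> \<rat>" "c' \<in> \<rat>" "d' \<in> \<rat>"
    and eq: "surd a b c d x y z = surd a' b' c' d' x y z"
  shows "a = a' \<and> b = b' \<and> c = c' \<and> d = d'"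
proof -
  have "surd (a - a') (b - b') (c - c') (d - d') x y z = 0"
    using eq by (simp add: surd_def algebra_simps)
  then show ?thesis
    using surd_eq_0[OF xyz, of "a - a'" "b - b'" "c - c'" "d - d'"] rat by simp
qed

text \<open>The value of P at the element has coordinates independent of the signs; by linear
  independence they are all 0, so P also vanishes at the conjugate.\<close>

lemma algebraic_int_conjugate:
  assumes xyz: "x\<^sup>2 = of_int g" "y\<^sup>2 = of_int e" "z\<^sup>2 = of_int f"
    and xyz': "x'\<^sup>2 = of_int g" "y'\<^sup>2 = of_int e" "z'\<^sup>2 = of_int f"
    and rat: "a \<in> \<rat>" "b \<in> \<rat>" "c \<in> \<rat>" "d \<in> \<rat>"
    and ai: "algebraic_int (surd a b c d x y z)"
  shows "algebraic_int (surd a b c d x' y' z')"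
proof -
  obtain P where P: "poly (map_poly of_int P) (surd a b c d x y z) = 0" "lead_coeff P = 1"
    using ai by (auto simp: algebraic_int_altdef_ipoly)
  obtain a' b' c' d' where rat': "a' \<in> \<rat>" "b' \<in> \<rat>" "c' \<in> \<rat>" "d' \<in> \<rat>"
    and *: "\<And>x y z. x\<^sup>2 = of_int g \<Longrightarrow> y\<^sup>2 = of_int e \<Longrightarrow> z\<^sup>2 = of_int f \<Longrightarrow>
      poly (map_poly of_int P) (surd a b c d x y z) = surd a' b' c' d' x y z"
    using poly_surd[OF _ _ _ rat, of "of_int g" "of_int e" "of_int f" P] by auto
  have "a' = 0 \<and> b' = 0 \<and> c' = 0 \<and> d' = 0"
    using surd_eq_0[OF xyz rat'] *[OF xyz] P(1) by simp
  then have "poly (map_poly of_int P) (surd a b c d x' y' z') = 0"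
    using *[OF xyz'] by (simp add: surd_def)
  with P(2) show ?thesis
    by (auto simp: algebraic_int_altdef_ipoly)
qed

end

text \<open>The classical description of the integers of Q(sqrt P), from trace and norm alone: with
  m = 2U and n = 2V the norm condition says m^2 = P n^2 mod 4.\<close>

lemma quadratic_integrality:
  fixes P :: int and U V :: real
  assumes P: "squarefree P" and rat: "U \<in> \<rat>" "V \<in> \<rat>"
    and trace: "2 * U \<in> \<int>" and norm: "U\<^sup>2 - P * V\<^sup>2 \<in> \<int>"
  obtains m n :: int where "2 * U = m" "2 * V = n"
    "if P mod 4 = 1 then even (m - n) else even m \<and> even n"
proof -
  obtain m where m: "2 * U = of_int m" using trace by (auto elim: Ints_cases)
  obtain k where k: "U\<^sup>2 - P * V\<^sup>2 = of_int k" using norm by (auto elim: Ints_cases)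
  have "of_int P * (2 * V)\<^sup>2 = (2 * U)\<^sup>2 - 4 * (U\<^sup>2 - P * V\<^sup>2)"
    by (simp add: power2_eq_square algebra_simps)
  also have "\<dots> = of_int (m\<^sup>2 - 4 * k)" by (simp only: m k) simp
  finally have PV: "of_int P * (2 * V)\<^sup>2 = of_int (m\<^sup>2 - 4 * k)" .
  have "2 * V \<in> \<int>"
  proof (rule squarefree_mult_square_int[OF P])
    show "2 * V \<in> \<rat>" using rat(2) by simp
    show "of_int P * (2 * V)\<^sup>2 \<in> \<int>" unfolding PV by (rule Ints_of_int)
  qed
  then obtain n where n: "2 * V = of_int n" by (auto elim: Ints_cases)
  have "real_of_int (P * n\<^sup>2) = of_int (m\<^sup>2 - 4 * k)" using PV n by simp
  then have eq: "P * n\<^sup>2 = m\<^sup>2 - 4 * k" by linarith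
  have P4: "P mod 4 \<noteq> 0"
  proof
    assume "P mod 4 = 0"
    then have "(2::int)\<^sup>2 dvd P" by auto
    then have "(2::int) dvd 1" using P squarefreeD by blast
    then show False by simp
  qed
  obtain P' where P': "P = 4 * P' + P mod 4" by (metis mult_div_mod_eq)
  then have "if P mod 4 = 1 then even (m - n) else even m \<and> even n"
  proof -
    consider "P mod 4 = 1" | "P mod 4 = 2" | "P mod 4 = 3" using P4 by atomize_elim presburger
    then show ?thesis
    proof cases
      case 1
      have "even (P * n\<^sup>2) \<longleftrightarrow> even (m\<^sup>2 - 4 * k)" using eq by simp
      moreover have "odd P" using 1 by presburger
      ultimately show ?thesis using 1 by simp
    next
      case 2
      have ev: "even m"
      proof -
        have "even P" using 2 by presburger
        then have "even (m\<^sup>2 - 4 * k)" using eq by (metis dvd_mult2)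
        then show ?thesis by simp
      qed
      then obtain m' where m': "m = 2 * m'" by (auto elim: evenE)
      have "(4 * P' + 2) * n\<^sup>2 = 4 * m'\<^sup>2 - 4 * k"
        using eq P' 2 m' by (simp add: power_mult_distrib)
      then have "n\<^sup>2 = 2 * (m'\<^sup>2 - k - P' * n\<^sup>2)" by (simp add: algebra_simps)
      then have "even n" by (metis dvd_triv_left even_power)
      with ev 2 show ?thesis by simp
    next
      case 3
      have "even (m - n)"
      proof -
        have "odd P" using 3 by presburger
        moreover have "even (P * n\<^sup>2) \<longleftrightarrow> even (m\<^sup>2 - 4 * k)" using eq by simp
        ultimately show ?thesis by simp
      qed
      moreover have "even n"
      proof (rule ccontr)
        assume "odd n"
        with \<open>even (m - n)\<close> have "odd m" by simp
        obtain n' m' where n': "n = 2 * n' + 1" and m': "m = 2 * m' + 1"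
          using \<open>odd n\<close> \<open>odd m\<close> by (auto elim!: oddE)
        have "(4 * P' + 3) * (2 * n' + 1)\<^sup>2 = (2 * m' + 1)\<^sup>2 - 4 * k"
          using eq P' 3 n' m' by metis
        \<comment> \<open>Odd squares are 1 mod 4, so the two sides would be 3 and 1 mod 4.\<close>
        then have "4 * (4 * P' * n'\<^sup>2 + 4 * P' * n' + P' + 3 * n'\<^sup>2 + 3 * n' - m'\<^sup>2 - m' + k) = -2"
          by (simp add: power2_eq_square algebra_simps)
        then have "4 dvd (-2 :: int)" by (metis dvd_triv_left)
        then show False by simp
      qed
      ultimately show ?thesis using 3 by simp
    qed
  qed
  with m n show ?thesis by (rule that)
qed

section \<open>Integral coordinates\<close>

context surd_triple
begin

text \<open>Changing the sign of y conjugates Q(sqrt(ef)); trace and norm are rational algebraic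
  integers, hence integers.\<close>

lemma subfield_parity:
  assumes xyz: "x\<^sup>2 = of_int g" "y\<^sup>2 = of_int e" "z\<^sup>2 = of_int f"
    and rat: "U \<in> \<rat>" "V \<in> \<rat>" and ai: "algebraic_int (surd U V 0 0 x y z)"
  obtains m n :: int where "2 * U = m" "2 * V = n"
    "if (e * f) mod 4 = 1 then even (m - n) else even m \<and> even n"
proof -
  have ai': "algebraic_int (surd U V 0 0 x (- y) z)"
    by (rule algebraic_int_conjugate[OF xyz _ _ _ _ _ _ _ ai]) (use xyz rat in auto)
  have "surd U V 0 0 x y z + surd U V 0 0 x (- y) z = 2 * U"
    by (simp add: surd_def)
  then have "2 * U \<in> \<int>"
    using rational_algebraic_int_is_int[OF algebraic_int_add_mult(1)[OF ai ai']] rat by simp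
  moreover have "surd U V 0 0 x y z * surd U V 0 0 x (- y) z = U\<^sup>2 - of_int (e * f) * V\<^sup>2"
    by (simp add: surd_def xyz[symmetric] power2_eq_square algebra_simps)
  then have "U\<^sup>2 - of_int (e * f) * V\<^sup>2 \<in> \<int>"
    using rational_algebraic_int_is_int[OF algebraic_int_add_mult(2)[OF ai ai']] rat by simp
  ultimately show ?thesis
    by (rule quadratic_integrality[OF squarefree(1) rat]) (rule that)
qed

text \<open>Changing the sign of x fixes yz and negates xy and xz, so adding this conjugate is the
  relative trace to Q(sqrt(ef)).\<close>

lemma trace_parity:
  assumes xyz: "x\<^sup>2 = of_int g" "y\<^sup>2 = of_int e" "z\<^sup>2 = of_int f"
    and rat: "a \<in> \<rat>" "b \<in> \<rat>" "c \<in> \<rat>" "d \<in> \<rat>" and ai: "algebraic_int (surd a b c d x y z)"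
  obtains m n :: int where "4 * a = m" "4 * b = n"
    "if (e * f) mod 4 = 1 then even (m - n) else even m \<and> even n"
proof -
  have ai': "algebraic_int (surd a b c d (- x) y z)"
    by (rule algebraic_int_conjugate[OF xyz _ _ _ rat ai]) (use xyz in auto)
  have "surd a b c d x y z + surd a b c d (- x) y z = surd (2 * a) (2 * b) 0 0 x y z"
    by (simp add: surd_def)
  then have "algebraic_int (surd (2 * a) (2 * b) 0 0 x y z)"
    using algebraic_int_add_mult(1)[OF ai ai'] by simp
  then show ?thesis
    using subfield_parity[OF xyz, of "2 * a" "2 * b"] that rat by auto
qed

text \<open>The same conjugation as in \<open>trace_parity\<close>, now with the relative norm to
  Q(sqrt(ef)).\<close>

lemma norm_parity:
  assumes xyz: "x\<^sup>2 = of_int g" "y\<^sup>2 = of_int e" "z\<^sup>2 = of_int f"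
    and rat: "a \<in> \<rat>" "b \<in> \<rat>" "c \<in> \<rat>" "d \<in> \<rat>" and ai: "algebraic_int (surd a b c d x y z)"
  obtains m n :: int where
    "2 * (a\<^sup>2 + of_int (e * f) * b\<^sup>2 - of_int (g * e) * c\<^sup>2 - of_int (g * f) * d\<^sup>2) = m"
    "4 * (a * b - of_int g * c * d) = n"
    "if (e * f) mod 4 = 1 then even (m - n) else even m \<and> even n"
proof -
  have ai': "algebraic_int (surd a b c d (- x) y z)"
    by (rule algebraic_int_conjugate[OF xyz _ _ _ rat ai]) (use xyz in auto)
  let ?U = "a\<^sup>2 + of_int (e * f) * b\<^sup>2 - of_int (g * e) * c\<^sup>2 - of_int (g * f) * d\<^sup>2"
  let ?V = "2 * (a * b - of_int g * c * d)"
  have "surd a b c d x y z * surd a b c d (- x) y z = surd ?U ?V 0 0 x y z"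
    by (simp add: surd_def xyz[symmetric] power2_eq_square algebra_simps)
  then have "algebraic_int (surd ?U ?V 0 0 x y z)"
    using algebraic_int_add_mult(2)[OF ai ai'] by simp
  moreover have "?U \<in> \<rat>" "?V \<in> \<rat>" using rat by simp_all
  ultimately obtain m n where "2 * ?U = of_int m" "2 * ?V = of_int n"
    "if (e * f) mod 4 = 1 then even (m - n) else even m \<and> even n"
    using subfield_parity[OF xyz, of ?U ?V] by metis
  then show ?thesis by (intro that[of m n]) simp_all
qed

text \<open>The relative traces to all three quadratic subfields, obtained by rotating (g, e, f);
  the three numerators of a agree because each equals 4a.\<close>

lemma coordinates_parity:
  assumes xyz: "x\<^sup>2 = of_int g" "y\<^sup>2 = of_int e" "z\<^sup>2 = of_int f"
    and rat: "a \<in> \<rat>" "b \<in> \<rat>" "c \<in> \<rat>" "d \<in> \<rat>" and ai: "algebraic_int (surd a b c d x y z)"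
  obtains m n k l :: int where "4 * a = m" "4 * b = n" "4 * c = k" "4 * d = l"
    "if (e * f) mod 4 = 1 then even (m - n) else even m \<and> even n"
    "if (g * e) mod 4 = 1 then even (m - k) else even m \<and> even k"
    "if (g * f) mod 4 = 1 then even (m - l) else even m \<and> even l"
proof -
  interpret r1: surd_triple f g e by (rule rotate)
  interpret r2: surd_triple e f g by (rule r1.rotate)
  have ai1: "algebraic_int (surd a c d b z x y)" using ai by (subst (asm) surd_rotate)
  have ai2: "algebraic_int (surd a d b c y z x)" using ai1 by (subst (asm) surd_rotate)
  obtain m n where 1: "4 * a = of_int m" "4 * b = of_int n"
    "if (e * f) mod 4 = 1 then even (m - n) else even m \<and> even n"
    by (rule trace_parity[OF xyz rat ai])
  obtain m2 k where 2: "4 * a = of_int m2" "4 * c = of_int k"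
    "if (g * e) mod 4 = 1 then even (m2 - k) else even m2 \<and> even k"
    by (rule r1.trace_parity[OF xyz(3,1,2) rat(1,3,4,2) ai1])
  obtain m3 l where 3: "4 * a = of_int m3" "4 * d = of_int l"
    "if (f * g) mod 4 = 1 then even (m3 - l) else even m3 \<and> even l"
    by (rule r2.trace_parity[OF xyz(2,3,1) rat(1,4,2,3) ai2])
  have "m2 = m" "m3 = m" using 1(1) 2(1) 3(1) by simp_all
  with 1 2 3 show ?thesis by (intro that[of m n k l]) (auto simp: mult.commute)
qed

lemma quarter_integers:
  assumes xyz: "x\<^sup>2 = of_int g" "y\<^sup>2 = of_int e" "z\<^sup>2 = of_int f"
    and rat: "a \<in> \<rat>" "b \<in> \<rat>" "c \<in> \<rat>" "d \<in> \<rat>" and ai: "algebraic_int (surd a b c d x y z)"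
    and mod4: "(e * f) mod 4 = 1" "(g * e) mod 4 = 1" "(g * f) mod 4 = 1"
  shows "\<exists>m n k l :: int. surd a b c d x y z = surd (m / 4) (n / 4) (k / 4) (l / 4) x y z \<and>
    even (m - n) \<and> even (m - k) \<and> even (m - l)"
proof -
  obtain m n k l :: int where *: "4 * a = m" "4 * b = n" "4 * c = k" "4 * d = l"
    "if (e * f) mod 4 = 1 then even (m - n) else even m \<and> even n"
    "if (g * e) mod 4 = 1 then even (m - k) else even m \<and> even k"
    "if (g * f) mod 4 = 1 then even (m - l) else even m \<and> even l"
    by (rule coordinates_parity[OF xyz rat ai])
  then have "even (m - n) \<and> even (m - k) \<and> even (m - l)" using mod4 by simp
  moreover from * have "a = m / 4" "b = n / 4" "c = k / 4" "d = l / 4" by simp_all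
  ultimately show ?thesis by blast
qed

text \<open>The traces make all numerators over 4 even. The relative norm then adds a congruence mod
  4 that the traces do not give.\<close>

lemma half_integers:
  assumes xyz: "x\<^sup>2 = of_int g" "y\<^sup>2 = of_int e" "z\<^sup>2 = of_int f"
    and rat: "a \<in> \<rat>" "b \<in> \<rat>" "c \<in> \<rat>" "d \<in> \<rat>" and ai: "algebraic_int (surd a b c d x y z)"
    and mod4: "(g * e) mod 4 \<noteq> 1" "(g * f) mod 4 \<noteq> 1"
  obtains m n k l :: int where "a = m / 2" "b = n / 2" "c = k / 2" "d = l / 2"
    "4 dvd m\<^sup>2 + e * f * n\<^sup>2 - g * e * k\<^sup>2 - g * f * l\<^sup>2 - 2 * (m * n - g * k * l)"
    "(e * f) mod 4 \<noteq> 1 \<longrightarrow> even (m * n - g * k * l)"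
proof -
  obtain m4 n4 k4 l4 :: int where *: "4 * a = m4" "4 * b = n4" "4 * c = k4" "4 * d = l4"
    "if (e * f) mod 4 = 1 then even (m4 - n4) else even m4 \<and> even n4"
    "if (g * e) mod 4 = 1 then even (m4 - k4) else even m4 \<and> even k4"
    "if (g * f) mod 4 = 1 then even (m4 - l4) else even m4 \<and> even l4"
    by (rule coordinates_parity[OF xyz rat ai])
  then have "even m4" "even k4" "even l4" "even n4"
    using mod4 by (auto split: if_splits)
  then obtain m n k l where "m4 = 2 * m" "n4 = 2 * n" "k4 = 2 * k" "l4 = 2 * l"
    by (auto elim!: evenE)
  with * have abcd: "a = m / 2" "b = n / 2" "c = k / 2" "d = l / 2"
    by simp_all
  obtain M N where MN:
    "2 * (a\<^sup>2 + of_int (e * f) * b\<^sup>2 - of_int (g * e) * c\<^sup>2 - of_int (g * f) * d\<^sup>2) = of_int M"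
    "4 * (a * b - of_int g * c * d) = of_int N"
    "if (e * f) mod 4 = 1 then even (M - N) else even M \<and> even N"
    by (rule norm_parity[OF xyz rat ai])
  have "real_of_int (m\<^sup>2 + e * f * n\<^sup>2 - g * e * k\<^sup>2 - g * f * l\<^sup>2) = of_int (2 * M)"
    using MN(1) by (simp add: abcd power2_eq_square field_simps)
  then have M: "m\<^sup>2 + e * f * n\<^sup>2 - g * e * k\<^sup>2 - g * f * l\<^sup>2 = 2 * M" by linarith
  have "real_of_int (m * n - g * k * l) = of_int N"
    using MN(2) by (simp add: abcd field_simps)
  then have N: "m * n - g * k * l = N" by linarith
  \<comment> \<open>M and N have equal parity in both residue classes of ef, so 2M - 2N is divisible
    by 4.\<close>
  have "even (M - N)" using MN(3) by (auto split: if_splits)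
  then obtain t where "M - N = 2 * t" by (rule evenE)
  then have "2 * M - 2 * N = 4 * t" by simp
  then have "4 dvd 2 * M - 2 * N" by simp
  then show ?thesis
    by (intro that[OF abcd]) (use M N MN(3) in \<open>auto split: if_splits\<close>)
qed

end

section \<open>Parities of half-integral coordinates\<close>

lemma odd_if_mod_4_eq_1: "(n :: int) mod 4 = 1 \<Longrightarrow> odd n"
  by presburger

lemma even_if_4_dvd_double: "4 dvd 2 * (n :: int) \<Longrightarrow> even n"
  by presburger

lemma four_dvd_sum_squares:
  fixes A B :: int
  assumes "4 dvd A\<^sup>2 + B\<^sup>2"
  shows "even A \<and> even B"
proof -
  have "even (A\<^sup>2 + B\<^sup>2)" using assms by (rule dvd_trans[rotated]) simp
  then have "even A \<longleftrightarrow> even B" by simp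
  moreover have False if "odd A" "odd B"
  proof -
    obtain s t where "A = 2 * s + 1" "B = 2 * t + 1" using \<open>odd A\<close> \<open>odd B\<close> by (auto elim!: oddE)
    then have "A\<^sup>2 + B\<^sup>2 = 4 * (s\<^sup>2 + s + t\<^sup>2 + t) + 2" by (simp add: power2_eq_square algebra_simps)
    with assms have "4 dvd (2::int)" by (metis dvd_add_right_iff dvd_triv_left)
    then show False by simp
  qed
  ultimately show ?thesis by blast
qed

lemma mod_4_product_one:
  fixes e f :: int
  assumes "(e * f) mod 4 = 1"
  shows "odd e" "e mod 4 = f mod 4"
proof -
  have "odd (e * f)" using assms by (rule odd_if_mod_4_eq_1)
  then show "odd e" by simp
  have "odd f" using \<open>odd (e * f)\<close> by simp
  have "e mod 4 = 1 \<or> e mod 4 = 3" using \<open>odd e\<close> by presburger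
  moreover have "f mod 4 = 1 \<or> f mod 4 = 3" using \<open>odd f\<close> by presburger
  moreover have "((e mod 4) * (f mod 4)) mod 4 = 1" using assms by (simp add: mod_mult_eq)
  ultimately show "e mod 4 = f mod 4" by auto
qed

context surd_triple
begin

text \<open>Here e = f mod 4, so ge = gf mod 4, and this is 2 or 3. The congruence of
  \<open>half_integers\<close> becomes (m - n)^2 = 2 (k^2 + l^2) mod 4 or (m - n)^2 + (k - l)^2 = 0
  mod 4; either gives both parities.\<close>

lemma half_integers_1:
  assumes xyz: "x\<^sup>2 = of_int g" "y\<^sup>2 = of_int e" "z\<^sup>2 = of_int f"
    and rat: "a \<in> \<rat>" "b \<in> \<rat>" "c \<in> \<rat>" "d \<in> \<rat>" and ai: "algebraic_int (surd a b c d x y z)"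
    and mod4: "(e * f) mod 4 = 1" "(g * e) mod 4 \<noteq> 1" "(g * f) mod 4 \<noteq> 1"
  shows "\<exists>m n k l :: int. surd a b c d x y z = surd (m / 2) (n / 2) (k / 2) (l / 2) x y z \<and>
    even (m - n) \<and> even (k - l)"
proof -
  obtain m n k l :: int where abcd: "a = m / 2" "b = n / 2" "c = k / 2" "d = l / 2"
    and four: "4 dvd m\<^sup>2 + e * f * n\<^sup>2 - g * e * k\<^sup>2 - g * f * l\<^sup>2 - 2 * (m * n - g * k * l)"
    by (rule half_integers[OF xyz rat ai mod4(2,3)])
  obtain q where q: "e * f = 4 * q + 1" by (metis mod4(1) mult_div_mod_eq)
  have ef: "odd e" "e mod 4 = f mod 4" using mod_4_product_one[OF mod4(1)] by auto
  have "4 dvd e - f" using ef(2) mod_eq_dvd_iff by blast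
  then have "4 dvd g * (e - f)" by simp
  then obtain p where p: "g * f = g * e - 4 * p" by (auto simp: algebra_simps elim!: dvdE)
  have nz: "(g * e) mod 4 \<noteq> 0"
  proof
    assume "(g * e) mod 4 = 0"
    then have "(2::int)\<^sup>2 dvd g * e" by auto
    then have "(2::int) dvd 1" using squarefree(2) squarefreeD by blast
    then show False by simp
  qed
  then consider "(g * e) mod 4 = 2" | "(g * e) mod 4 = 3"
    using mod4(2) by atomize_elim presburger
  then have "even (m - n) \<and> even (k - l)"
  proof cases
    case 1
    then obtain r where r: "g * e = 4 * r + 2" by (metis mult_div_mod_eq)
    have "even (g * e)" unfolding r by simp
    then obtain h where h: "g = 2 * h" using ef(1) by auto
    have "m\<^sup>2 + e * f * n\<^sup>2 - g * e * k\<^sup>2 - g * f * l\<^sup>2 - 2 * (m * n - g * k * l) =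
      4 * (q * n\<^sup>2 - r * k\<^sup>2 - r * l\<^sup>2 + p * l\<^sup>2 + h * k * l) + ((m - n)\<^sup>2 - 2 * (k\<^sup>2 + l\<^sup>2))"
      unfolding p q r by (simp add: h power2_eq_square algebra_simps)
    then have 4: "4 dvd (m - n)\<^sup>2 - 2 * (k\<^sup>2 + l\<^sup>2)"
      using four by (metis dvd_add_right_iff dvd_triv_left)
    then have "even ((m - n)\<^sup>2 - 2 * (k\<^sup>2 + l\<^sup>2))" by (rule dvd_trans[rotated]) simp
    then have ev: "even (m - n)" by simp
    then obtain s where "m - n = 2 * s" by (rule evenE)
    with 4 have "4 dvd 4 * s\<^sup>2 - 2 * (k\<^sup>2 + l\<^sup>2)" by (simp add: power_mult_distrib)
    then have "4 dvd 2 * (k\<^sup>2 + l\<^sup>2)" by (simp add: dvd_diff_right_iff)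
    then have "even (k\<^sup>2 + l\<^sup>2)" by (rule even_if_4_dvd_double)
    with ev show ?thesis by simp
  next
    case 2
    then obtain r where r: "g * e = 4 * r + 3" by (metis mult_div_mod_eq)
    have "odd (g * e)" unfolding r by simp
    then obtain h where h: "g = 2 * h + 1" by (auto elim: oddE)
    have "m\<^sup>2 + e * f * n\<^sup>2 - g * e * k\<^sup>2 - g * f * l\<^sup>2 - 2 * (m * n - g * k * l) =
      4 * (q * n\<^sup>2 - (r + 1) * k\<^sup>2 - (r + 1) * l\<^sup>2 + p * l\<^sup>2 + (h + 1) * k * l) + ((m - n)\<^sup>2 + (k - l)\<^sup>2)"
      unfolding p q r by (simp add: h power2_eq_square algebra_simps)
    then have "4 dvd (m - n)\<^sup>2 + (k - l)\<^sup>2"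
      using four by (metis dvd_add_right_iff dvd_triv_left)
    then show ?thesis by (rule four_dvd_sum_squares)
  qed
  then show ?thesis using abcd by blast
qed

text \<open>As g is even, mn is even and m^2 + 3n^2 is even, so m and n are even. With g = 2h the
  congruence mod 4 leaves h (e k^2 + f l^2) even, where h is odd by squarefreeness and e, f are
  odd.\<close>

lemma half_integers_3:
  assumes xyz: "x\<^sup>2 = of_int g" "y\<^sup>2 = of_int e" "z\<^sup>2 = of_int f"
    and rat: "a \<in> \<rat>" "b \<in> \<rat>" "c \<in> \<rat>" "d \<in> \<rat>" and ai: "algebraic_int (surd a b c d x y z)"
    and mod4: "(e * f) mod 4 = 3" and g: "even g"
  shows "\<exists>m n k l :: int. surd a b c d x y z = surd (m / 2) (n / 2) (k / 2) (l / 2) x y z \<and>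
    even m \<and> even n \<and> even (k - l)"
proof -
  obtain h where h: "g = 2 * h" using g by (auto elim: evenE)
  have "even (g * e)" "even (g * f)" using g by simp_all
  then have ng: "(g * e) mod 4 \<noteq> 1" "(g * f) mod 4 \<noteq> 1"
    using odd_if_mod_4_eq_1 by blast+
  obtain m n k l :: int where abcd: "a = m / 2" "b = n / 2" "c = k / 2" "d = l / 2"
    and four: "4 dvd m\<^sup>2 + e * f * n\<^sup>2 - g * e * k\<^sup>2 - g * f * l\<^sup>2 - 2 * (m * n - g * k * l)"
    and two': "(e * f) mod 4 \<noteq> 1 \<longrightarrow> even (m * n - g * k * l)"
    by (rule half_integers[OF xyz rat ai ng])
  have two: "even (m * n - g * k * l)" using two' by (simp add: mod4)
  obtain q where q: "e * f = 4 * q + 3" by (metis mod4 mult_div_mod_eq)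
  have "even (m * n)" using two g by simp
  have "even (m\<^sup>2 + e * f * n\<^sup>2 - g * e * k\<^sup>2 - g * f * l\<^sup>2 - 2 * (m * n - g * k * l))"
    using four by (rule dvd_trans[rotated]) simp
  then have "even (m\<^sup>2 + (4 * q + 3) * n\<^sup>2)" unfolding q h by simp
  then have "even m \<longleftrightarrow> even n" by simp
  with \<open>even (m * n)\<close> have mn: "even m" "even n" by auto
  then obtain m' n' where m': "m = 2 * m'" and n': "n = 2 * n'" by (auto elim!: evenE)
  have "m\<^sup>2 + e * f * n\<^sup>2 - g * e * k\<^sup>2 - g * f * l\<^sup>2 - 2 * (m * n - g * k * l) =
    4 * (m'\<^sup>2 + e * f * n'\<^sup>2 - 2 * m' * n' + h * k * l) - 2 * (h * (e * k\<^sup>2 + f * l\<^sup>2))"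
    unfolding m' n' h by (simp add: power2_eq_square algebra_simps)
  then have "4 dvd 2 * (h * (e * k\<^sup>2 + f * l\<^sup>2))"
    using four by (metis dvd_diff_right_iff dvd_triv_left)
  then have "even (h * (e * k\<^sup>2 + f * l\<^sup>2))" by (rule even_if_4_dvd_double)
  moreover have "odd e" "odd f"
  proof -
    have "odd (e * f)" unfolding q by simp
    then show "odd e" "odd f" by simp_all
  qed
  moreover have "odd h"
  proof
    assume "even h"
    then have "(2::int)\<^sup>2 dvd g * e" using h by auto
    then have "(2::int) dvd 1" using squarefree(2) squarefreeD by blast
    then show False by simp
  qed
  ultimately have "even (k - l)" by simp
  with mn abcd show ?thesis by blast
qed

end

section \<open>Integral forms over a biquadratic field\<close>

text \<open>Both Q and its polarisation are values of this functional, which is linear in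
  \<open>h\<close>, so expanding Q needs only additivity and scaling. The ring is general because Q
  is evaluated on real vectors and on integral coordinate vectors.\<close>

definition form_sum :: "nat \<Rightarrow> (nat \<Rightarrow> nat \<Rightarrow> int) \<Rightarrow> (nat \<Rightarrow> nat \<Rightarrow> 'a :: comm_ring_1) \<Rightarrow> 'a" where
  "form_sum r A h = (\<Sum>i<r. \<Sum>j<r. if i \<le> j then of_int (A i j) * h i j else 0)"

definition quad :: "nat \<Rightarrow> (nat \<Rightarrow> nat \<Rightarrow> int) \<Rightarrow> (nat \<Rightarrow> 'a :: comm_ring_1) \<Rightarrow> 'a" where
  "quad r A u = form_sum r A (\<lambda>i j. u i * u j)"

text \<open>The polarisation B without a factor 1/2, so that B(u,u) = 2 Q(u) and B is integral on
  integral vectors.\<close>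

definition polar :: "nat \<Rightarrow> (nat \<Rightarrow> nat \<Rightarrow> int) \<Rightarrow> (nat \<Rightarrow> 'a :: comm_ring_1) \<Rightarrow> (nat \<Rightarrow> 'a) \<Rightarrow> 'a" where
  "polar r A u w = form_sum r A (\<lambda>i j. u i * w j + w i * u j)"

lemma form_sum_add: "form_sum r A (\<lambda>i j. h i j + k i j) = form_sum r A h + form_sum r A k"
  by (simp add: form_sum_def sum.distrib[symmetric] distrib_left if_distrib cong: if_cong)

lemma form_sum_scale: "form_sum r A (\<lambda>i j. c * h i j) = c * form_sum r A h"
  unfolding form_sum_def sum_distrib_left by (intro sum.cong refl) (simp add: mult.left_commute)

lemma form_sum_cong:
  "(\<And>i j. i < r \<Longrightarrow> j < r \<Longrightarrow> h i j = k i j) \<Longrightarrow> form_sum r A h = form_sum r A k"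
  unfolding form_sum_def by (intro sum.cong refl) simp

lemma of_int_form_sum: "of_int (form_sum r A h) = form_sum r A (\<lambda>i j. of_int (h i j))"
  unfolding form_sum_def of_int_sum by (intro sum.cong refl) simp

lemma qform_eq_quad: "qform r A v = quad r A v"
  by (simp add: qform_def quad_def form_sum_def mult.assoc cong: if_cong)

lemma quad_cong: "(\<And>i. i < r \<Longrightarrow> u i = w i) \<Longrightarrow> quad r A u = quad r A w"
  unfolding quad_def by (rule form_sum_cong) simp

lemma of_int_quad: "of_int (quad r A u) = quad r A (\<lambda>i. of_int (u i))"
  by (simp add: quad_def of_int_form_sum)

lemma of_int_polar: "of_int (polar r A u w) = polar r A (\<lambda>i. of_int (u i)) (\<lambda>i. of_int (w i))"
  by (simp add: polar_def of_int_form_sum)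

lemma quad_scale: "quad r A (\<lambda>i. c * u i) = c\<^sup>2 * quad r A u"
proof -
  have "quad r A (\<lambda>i. c * u i) = form_sum r A (\<lambda>i j. c\<^sup>2 * (u i * u j))"
    unfolding quad_def by (rule form_sum_cong) (simp add: power2_eq_square mult_ac)
  then show ?thesis by (simp add: form_sum_scale quad_def)
qed

lemma quad_add: "quad r A (\<lambda>i. u i + w i) = quad r A u + quad r A w + polar r A u w"
proof -
  have "quad r A (\<lambda>i. u i + w i) =
      form_sum r A (\<lambda>i j. (u i * u j + w i * w j) + (u i * w j + w i * u j))"
    unfolding quad_def by (rule form_sum_cong) (simp add: algebra_simps)
  then show ?thesis by (simp add: form_sum_add quad_def polar_def)
qed

lemma quad_eq_0: "(\<And>i. i < r \<Longrightarrow> u i = 0) \<Longrightarrow> quad r A u = 0"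
  using quad_cong[of r u "\<lambda>_. 0" A] by (simp add: quad_def form_sum_def cong: if_cong)

lemma polar_eq_0_left: "(\<And>i. i < r \<Longrightarrow> u i = 0) \<Longrightarrow> polar r A u w = 0"
  using form_sum_cong[of r "\<lambda>i j. u i * w j + w i * u j" "\<lambda>_ _. 0" A]
  by (simp add: polar_def form_sum_def cong: if_cong)

lemma polar_commute: "polar r A u w = polar r A w u"
  by (simp add: polar_def add.commute)

text \<open>The product of two of the roots yz, xy, xz is the third one times g, e or f, which
  explains the factor of the second polar term in each coordinate.\<close>

lemma quad_surd:
  fixes g e f :: real
  assumes xyz: "x\<^sup>2 = g" "y\<^sup>2 = e" "z\<^sup>2 = f"
  shows "quad r A (\<lambda>i. surd (a i) (b i) (c i) (d i) x y z) =
    surd (quad r A a + e * f * quad r A b + g * e * quad r A c + g * f * quad r A d)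
      (polar r A a b + g * polar r A c d)
      (polar r A a c + f * polar r A b d)
      (polar r A a d + e * polar r A b c) x y z"
proof -
  have "quad r A (\<lambda>i. surd (a i) (b i) (c i) (d i) x y z) =
    form_sum r A (\<lambda>i j. a i * a j + (e * f) * (b i * b j) + (g * e) * (c i * c j) + (g * f) * (d i * d j)
      + (y * z) * ((a i * b j + b i * a j) + g * (c i * d j + d i * c j))
      + (x * y) * ((a i * c j + c i * a j) + f * (b i * d j + d i * b j))
      + (x * z) * ((a i * d j + d i * a j) + e * (b i * c j + c i * b j)))"
    unfolding quad_def surd_mult[OF xyz]
    by (rule form_sum_cong) (simp add: surd_def algebra_simps)
  also have "\<dots> = surd (quad r A a + e * f * quad r A b + g * e * quad r A c + g * f * quad r A d)
      (polar r A a b + g * polar r A c d)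
      (polar r A a c + f * polar r A b d)
      (polar r A a d + e * polar r A b c) x y z"
    unfolding form_sum_add form_sum_scale quad_def polar_def
    by (simp add: surd_def algebra_simps)
  finally show ?thesis .
qed

locale positive_form =
  fixes r :: nat and A :: "nat \<Rightarrow> nat \<Rightarrow> int"
  assumes positive: "Z_form r A"
begin

lemma quad_pos: "\<exists>i<r. u i \<noteq> 0 \<Longrightarrow> quad r A u > (0 :: int)"
proof -
  assume "\<exists>i<r. u i \<noteq> 0"
  then have "qform r A (\<lambda>i. of_int (u i)) > 0"
    using positive unfolding Z_form_def by simp
  then show ?thesis
    by (simp add: qform_eq_quad of_int_quad[symmetric])
qed

lemma quad_nonneg: "quad r A u \<ge> (0 :: int)"
  using quad_pos[of u] quad_eq_0[of r u A] by force

lemma quad_eq_0D: "quad r A u = (0 :: int) \<Longrightarrow> i < r \<Longrightarrow> u i = 0"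
  using quad_pos[of u] by force

lemma polar_eq_0: "quad r A u = (0 :: int) \<Longrightarrow> polar r A u w = 0"
  "quad r A u = (0 :: int) \<Longrightarrow> polar r A w u = 0"
  using quad_eq_0D polar_eq_0_left polar_commute by metis+

lemma quad_even:
  assumes "\<And>i. i < r \<Longrightarrow> even (u i :: int)"
  obtains k where "quad r A u = 4 * k" "k \<ge> 0"
proof -
  have "quad r A u = quad r A (\<lambda>i. 2 * (u i div 2))"
    by (rule quad_cong) (simp add: assms)
  also have "\<dots> = 4 * quad r A (\<lambda>i. u i div 2)"
    by (simp add: quad_scale)
  finally show ?thesis using quad_nonneg that by blast
qed

end

section \<open>Totally positive integers of the field\<close>

definition surd_field :: "real \<Rightarrow> real \<Rightarrow> real \<Rightarrow> real set" where
  "surd_field x y z = {surd a b c d x y z |a b c d. a \<in> \<rat> \<and> b \<in> \<rat> \<and> c \<in> \<rat> \<and> d \<in> \<rat>}"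

text \<open>p and q enter only through the field, so g, e, f can be permuted while p and q stay
  fixed.\<close>

locale biquadratic = surd_triple g e f for g e f :: int +
  fixes p q :: int and x y z :: real
  assumes xyz: "x\<^sup>2 = of_int g" "y\<^sup>2 = of_int e" "z\<^sup>2 = of_int f"
    and field: "biquad_field p q = surd_field x y z"
begin

lemma surd_in_field: "a \<in> \<rat> \<Longrightarrow> b \<in> \<rat> \<Longrightarrow> c \<in> \<rat> \<Longrightarrow> d \<in> \<rat> \<Longrightarrow> surd a b c d x y z \<in> biquad_field p q"
  unfolding field surd_field_def by blast

lemma field_add: "u \<in> biquad_field p q \<Longrightarrow> w \<in> biquad_field p q \<Longrightarrow> u + w \<in> biquad_field p q"
  unfolding field surd_field_def by (clarsimp simp: surd_add) (metis Rats_add)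

lemma field_mult: "u \<in> biquad_field p q \<Longrightarrow> w \<in> biquad_field p q \<Longrightarrow> u * w \<in> biquad_field p q"
proof -
  assume "u \<in> biquad_field p q" "w \<in> biquad_field p q"
  then obtain a b c d a' b' c' d' where "u = surd a b c d x y z" "w = surd a' b' c' d' x y z"
    "a \<in> \<rat>" "b \<in> \<rat>" "c \<in> \<rat>" "d \<in> \<rat>" "a' \<in> \<rat>" "b' \<in> \<rat>" "c' \<in> \<rat>" "d' \<in> \<rat>"
    unfolding field surd_field_def by auto
  then show ?thesis
    by (simp only: surd_mult[OF xyz]) (intro surd_in_field; simp)
qed

lemma one_in_field: "1 \<in> biquad_field p q"
  using surd_in_field[of 1 0 0 0] by (simp add: surd_def)

text \<open>The equation is written without subtraction since only sums and products in the field are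
  known to be respected by an embedding.\<close>

lemma totally_positive_quadratic:
  assumes \<alpha>: "\<alpha> \<in> biquad_field p q" "\<alpha> * \<alpha> + of_nat N = of_nat m * \<alpha>" and N: "N > 0"
  shows "\<alpha> \<in> ring_of_integers p q" "totally_positive p q \<alpha>"
proof -
  have "algebraic_int \<alpha>"
  proof (rule algebraic_int.intros)
    show "lead_coeff [:of_nat N, - of_nat m, 1 :: real:] = 1" by simp
    show "\<forall>i. coeff [:of_nat N, - of_nat m, 1 :: real:] i \<in> \<int>"
      by (auto simp: coeff_pCons split: nat.splits)
    show "poly [:of_nat N, - of_nat m, 1:] \<alpha> = 0"
      using \<alpha>(2) by (simp add: algebra_simps)
  qed
  with \<alpha> show "\<alpha> \<in> ring_of_integers p q" by (simp add: ring_of_integers_def)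
  show "totally_positive p q \<alpha>"
    unfolding totally_positive_def
  proof (intro allI impI)
    fix \<sigma> assume "real_embedding p q \<sigma>"
    then have one: "\<sigma> 1 = 1"
      and add: "\<And>u w. u \<in> biquad_field p q \<Longrightarrow> w \<in> biquad_field p q \<Longrightarrow> \<sigma> (u + w) = \<sigma> u + \<sigma> w"
      and mult: "\<And>u w. u \<in> biquad_field p q \<Longrightarrow> w \<in> biquad_field p q \<Longrightarrow> \<sigma> (u * w) = \<sigma> u * \<sigma> w"
      unfolding real_embedding_def by blast+
    have zero: "0 \<in> biquad_field p q" "\<sigma> 0 = 0"
      using surd_in_field[of 0 0 0 0] add[of 0 0] by (simp_all add: surd_def)
    have nat_mult: "of_nat k * w \<in> biquad_field p q \<and> \<sigma> (of_nat k * w) = of_nat k * \<sigma> w"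
      if "w \<in> biquad_field p q" for k w
      by (induction k) (use that zero in \<open>auto simp: distrib_right field_add add\<close>)
    have "\<sigma> (\<alpha> * \<alpha> + of_nat N * 1) = \<sigma> (of_nat m * \<alpha>)"
      using \<alpha>(2) by simp
    then have "\<sigma> \<alpha> * \<sigma> \<alpha> + of_nat N = of_nat m * \<sigma> \<alpha>"
      using \<alpha>(1) field_mult nat_mult[OF one_in_field] nat_mult[OF \<alpha>(1)]
      by (simp add: add mult one)
    \<comment> \<open>If \<open>\<sigma> \<alpha>\<close> were not positive, the right side of the
      equation would not be either.\<close>
    moreover have "\<sigma> \<alpha> * \<sigma> \<alpha> + of_nat N > 0"
      using N by (simp add: add_nonneg_pos)
    ultimately show "\<sigma> \<alpha> > 0"
      by (metis of_nat_0_le_iff mult_nonneg_nonpos not_less)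
  qed
qed

text \<open>The element is a root of X^2 - m X + N with N = (m^2 - n^2 P) / 4, and both m and N are
  positive integers.\<close>

lemma surd_totally_positive:
  fixes m n P :: int
  assumes s: "s \<in> biquad_field p q" "s\<^sup>2 = of_int P"
    and mn: "m > 0" "n\<^sup>2 * P < m\<^sup>2" "4 dvd m\<^sup>2 - n\<^sup>2 * P"
    and \<alpha>: "\<alpha> = of_int m / 2 + of_int n / 2 * s" "\<alpha> \<in> biquad_field p q"
  shows "\<alpha> \<in> ring_of_integers p q" "totally_positive p q \<alpha>"
proof -
  obtain N where N: "m\<^sup>2 - n\<^sup>2 * P = 4 * N" using mn(3) by (auto elim: dvdE)
  then have "N > 0" using mn(2) by simp
  have "(of_int m)\<^sup>2 - (of_int n)\<^sup>2 * s\<^sup>2 = 4 * real_of_int N"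
    using arg_cong[OF N, of real_of_int] by (simp add: s)
  then have "\<alpha> * \<alpha> + of_nat (nat N) = of_nat (nat m) * \<alpha>"
    using mn(1) \<open>N > 0\<close> unfolding \<alpha> by (simp add: field_simps power2_eq_square)
  then show "\<alpha> \<in> ring_of_integers p q" "totally_positive p q \<alpha>"
    using totally_positive_quadratic[OF \<alpha>(2), of "nat N" "nat m"] \<open>N > 0\<close> by simp_all
qed

end

section \<open>Representations in integral coordinates\<close>

locale universal_form = biquadratic g e f p q x y z + positive_form r A
  for g e f p q :: int and x y z :: real and r :: nat and A +
  assumes universal: "universal_over p q r A"
begin

text \<open>\<open>R\<close> carries the parities of the numerators over K. The factor K^2 comes
  from clearing the denominators of v, the factor 2 from the halves in the represented
  element.\<close>

lemma representation:
  fixes K :: int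
  assumes integral: "\<And>a b c d. a \<in> \<rat> \<Longrightarrow> b \<in> \<rat> \<Longrightarrow> c \<in> \<rat> \<Longrightarrow> d \<in> \<rat> \<Longrightarrow>
      algebraic_int (surd a b c d x y z) \<Longrightarrow>
      \<exists>m n k l :: int. surd a b c d x y z = surd (m / K) (n / K) (k / K) (l / K) x y z \<and> R m n k l"
    and K: "K > 0"
    and \<alpha>: "surd (m0 / 2) (m1 / 2) (m2 / 2) (m3 / 2) x y z \<in> ring_of_integers p q"
      "totally_positive p q (surd (m0 / 2) (m1 / 2) (m2 / 2) (m3 / 2) x y z)"
  obtains a b c d :: "nat \<Rightarrow> int" where "\<And>i. i < r \<Longrightarrow> R (a i) (b i) (c i) (d i)"
    "2 * (quad r A a + e * f * quad r A b + g * e * quad r A c + g * f * quad r A d) = K\<^sup>2 * m0"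
    "2 * (polar r A a b + g * polar r A c d) = K\<^sup>2 * m1"
    "2 * (polar r A a c + f * polar r A b d) = K\<^sup>2 * m2"
    "2 * (polar r A a d + e * polar r A b c) = K\<^sup>2 * m3"
proof -
  obtain v where v: "\<And>i. i < r \<Longrightarrow> v i \<in> ring_of_integers p q"
    and Qv: "quad r A v = surd (m0 / 2) (m1 / 2) (m2 / 2) (m3 / 2) x y z"
    using universal[unfolded universal_over_def qform_eq_quad, rule_format, OF \<alpha>] by blast
  have "\<exists>m n k l :: int. v i = surd (m / K) (n / K) (k / K) (l / K) x y z \<and> R m n k l" if i: "i < r" for i
  proof -
    have "v i \<in> surd_field x y z" "algebraic_int (v i)"
      using v[OF i] by (simp_all add: ring_of_integers_def field)
    then obtain a b c d where "a \<in> \<rat>" "b \<in> \<rat>" "c \<in> \<rat>" "d \<in> \<rat>" and vi: "v i = surd a b c d x y z"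
      unfolding surd_field_def by auto
    then show ?thesis
      using integral[of a b c d] \<open>algebraic_int (v i)\<close> unfolding vi by simp
  qed
  then obtain a b c d :: "nat \<Rightarrow> int" where
    abcd: "\<And>i. i < r \<Longrightarrow> v i = surd (a i / K) (b i / K) (c i / K) (d i / K) x y z"
      "\<And>i. i < r \<Longrightarrow> R (a i) (b i) (c i) (d i)"
    by metis
  let ?a = "\<lambda>i. real_of_int (a i)" and ?b = "\<lambda>i. real_of_int (b i)"
  let ?c = "\<lambda>i. real_of_int (c i)" and ?d = "\<lambda>i. real_of_int (d i)"
  have "quad r A (\<lambda>i. surd (?a i) (?b i) (?c i) (?d i) x y z) = quad r A (\<lambda>i. of_int K * v i)"
    by (rule quad_cong) (use abcd(1) K in \<open>simp add: surd_def field_simps\<close>)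
  also have "\<dots> = (of_int K)\<^sup>2 * quad r A v" by (rule quad_scale)
  also have "\<dots> = surd (K\<^sup>2 * m0 / 2) (K\<^sup>2 * m1 / 2) (K\<^sup>2 * m2 / 2) (K\<^sup>2 * m3 / 2) x y z"
    unfolding Qv by (simp add: surd_def field_simps)
  finally have "surd (quad r A a + e * f * quad r A b + g * e * quad r A c + g * f * quad r A d)
      (polar r A a b + g * polar r A c d) (polar r A a c + f * polar r A b d)
      (polar r A a d + e * polar r A b c) x y z =
    surd (K\<^sup>2 * m0 / 2) (K\<^sup>2 * m1 / 2) (K\<^sup>2 * m2 / 2) (K\<^sup>2 * m3 / 2) x y z"
    by (simp add: quad_surd[OF xyz] of_int_quad of_int_polar)
  then have "real_of_int (quad r A a + e * f * quad r A b + g * e * quad r A c + g * f * quad r A d) = K\<^sup>2 * m0 / 2 \<and>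
    real_of_int (polar r A a b + g * polar r A c d) = K\<^sup>2 * m1 / 2 \<and>
    real_of_int (polar r A a c + f * polar r A b d) = K\<^sup>2 * m2 / 2 \<and>
    real_of_int (polar r A a d + e * polar r A b c) = K\<^sup>2 * m3 / 2"
    by (rule surd_inject[OF xyz, rotated -1]) simp_all
  then have "real_of_int (2 * (quad r A a + e * f * quad r A b + g * e * quad r A c + g * f * quad r A d)) = of_int (K\<^sup>2 * m0) \<and>
    real_of_int (2 * (polar r A a b + g * polar r A c d)) = of_int (K\<^sup>2 * m1) \<and>
    real_of_int (2 * (polar r A a c + f * polar r A b d)) = of_int (K\<^sup>2 * m2) \<and>
    real_of_int (2 * (polar r A a d + e * polar r A b c)) = of_int (K\<^sup>2 * m3)"
    by simp
  then show ?thesis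
    unfolding of_int_eq_iff by (intro that[of a b c d] abcd(2)) auto
qed

end

section \<open>Elements that are not represented\<close>

locale sorted_form = universal_form +
  assumes sorted: "g < e" "e < f"
begin

lemma bounds: "1 \<le> g" "2 \<le> e" "3 \<le> f" "g * f < e * f" "e \<le> g * e" "f \<le> g * f"
  using pos sorted by simp_all

lemma not_square_dvd:
  assumes "k > 1"
  shows "\<not> k\<^sup>2 dvd e * f" "\<not> k\<^sup>2 dvd g * e" "\<not> k\<^sup>2 dvd g * f"
  using squarefree squarefreeD[of _ k] assms by auto

lemma floor_sqrt:
  obtains u where "u \<ge> 1" "u\<^sup>2 < g * f" "g * f < (u + 1)\<^sup>2"
proof -
  define N where "N = g * f"
  have N: "N > 1" using nontriv(3) by (simp add: N_def)
  define u where "u = \<lfloor>sqrt (of_int N)\<rfloor>"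
  have "1 \<le> sqrt (of_int N)" using N by simp
  then have u1: "u \<ge> 1" unfolding u_def by linarith
  have "of_int u \<le> sqrt (of_int N)" "sqrt (of_int N) < of_int (u + 1)"
    unfolding u_def by linarith+
  then have "(of_int u)\<^sup>2 \<le> (sqrt (of_int N))\<^sup>2" "(sqrt (of_int N))\<^sup>2 < (of_int (u + 1))\<^sup>2"
    using u1 N by (intro power_mono power_strict_mono; simp)+
  then have "real_of_int (u\<^sup>2) \<le> of_int N" "of_int N < real_of_int ((u + 1)\<^sup>2)"
    using N by simp_all
  then have "u\<^sup>2 \<le> g * f" "g * f < (u + 1)\<^sup>2" unfolding N_def by linarith+
  moreover have "u\<^sup>2 \<noteq> g * f"
  proof (cases "u = 1")
    case False
    then show ?thesis using not_square_dvd(3)[of u] u1 by auto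
  qed (use nontriv in simp)
  ultimately show ?thesis using that[OF u1] by simp
qed

text \<open>\<open>R\<close> is only a necessary condition on the numerators, not a characterisation
  of integrality.\<close>

definition integral_coordinates :: "int \<Rightarrow> (int \<Rightarrow> int \<Rightarrow> int \<Rightarrow> int \<Rightarrow> bool) \<Rightarrow> bool" where
  "integral_coordinates K R \<longleftrightarrow> K > 0 \<and> (\<forall>a\<in>\<rat>. \<forall>b\<in>\<rat>. \<forall>c\<in>\<rat>. \<forall>d\<in>\<rat>.
      algebraic_int (surd a b c d x y z) \<longrightarrow>
      (\<exists>m n k l :: int. surd a b c d x y z = surd (m / K) (n / K) (k / K) (l / K) x y z \<and> R m n k l))"

text \<open>The set membership selects which of the three roots accompanies m/2: P is its radicand,
  and (n1, n2, n3) has n in its place.\<close>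

lemma representation_single:
  assumes K: "integral_coordinates K R"
    and s: "(P, n1, n2, n3) \<in> {(e * f, n, 0, 0), (g * e, 0, n, 0), (g * f, 0, 0, n)}"
    and m: "m > 0" "n\<^sup>2 * P < m\<^sup>2" "4 dvd m\<^sup>2 - n\<^sup>2 * P"
  obtains a b c d :: "nat \<Rightarrow> int" where "\<forall>i<r. R (a i) (b i) (c i) (d i)"
    "2 * (quad r A a + e * f * quad r A b + g * e * quad r A c + g * f * quad r A d) = K\<^sup>2 * m"
    "2 * (polar r A a b + g * polar r A c d) = K\<^sup>2 * n1"
    "2 * (polar r A a c + f * polar r A b d) = K\<^sup>2 * n2"
    "2 * (polar r A a d + e * polar r A b c) = K\<^sup>2 * n3"
proof -
  let ?\<alpha> = "surd (of_int m / 2) (of_int n1 / 2) (of_int n2 / 2) (of_int n3 / 2) x y z"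
  have \<alpha>: "?\<alpha> \<in> biquad_field p q"
    by (rule surd_in_field) simp_all
  have *: "?\<alpha> \<in> ring_of_integers p q \<and> totally_positive p q ?\<alpha>"
    if "s \<in> biquad_field p q" "s\<^sup>2 = of_int P" "?\<alpha> = of_int m / 2 + of_int n / 2 * s" for s
    using surd_totally_positive[OF that(1,2) m that(3) \<alpha>] by blast
  have roots: "y * z \<in> biquad_field p q" "x * y \<in> biquad_field p q" "x * z \<in> biquad_field p q"
    using surd_in_field[of 0 1 0 0] surd_in_field[of 0 0 1 0] surd_in_field[of 0 0 0 1]
    by (simp_all add: surd_def)
  have "(y * z)\<^sup>2 = of_int (e * f)" "(x * y)\<^sup>2 = of_int (g * e)" "(x * z)\<^sup>2 = of_int (g * f)"
    by (simp_all add: power_mult_distrib xyz)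
  note roots = roots this
  have "?\<alpha> \<in> ring_of_integers p q \<and> totally_positive p q ?\<alpha>"
    using s[unfolded insert_iff empty_iff prod.inject]
  proof (elim disjE)
    assume "P = e * f \<and> n1 = n \<and> n2 = 0 \<and> n3 = 0"
    then show ?thesis using roots by (intro *[of "y * z"]) (simp_all add: surd_def)
  next
    assume "P = g * e \<and> n1 = 0 \<and> n2 = n \<and> n3 = 0"
    then show ?thesis using roots by (intro *[of "x * y"]) (simp_all add: surd_def)
  next
    assume "P = g * f \<and> n1 = 0 \<and> n2 = 0 \<and> n3 = n"
    then show ?thesis using roots by (intro *[of "x * z"]) (simp_all add: surd_def)
  qed simp
  then show ?thesis
    using representation[of K R m n1 n2 n3] K that unfolding integral_coordinates_def by blast
qed

text \<open>Here the represented element is (u + 1) + sqrt(gf), and below it is (T + sqrt(gf)) / 2.\<close>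

lemma representation_ceiling:
  assumes R: "integral_coordinates 2 R"
  obtains u and a b c d :: "nat \<Rightarrow> int" where "u \<ge> 1" "u\<^sup>2 < g * f" "g * f < (u + 1)\<^sup>2"
    "\<And>i. i < r \<Longrightarrow> R (a i) (b i) (c i) (d i)"
    "quad r A a + e * f * quad r A b + g * e * quad r A c + g * f * quad r A d = 4 * (u + 1)"
    "polar r A a d + e * polar r A b c = 4"
proof -
  obtain u where u: "u \<ge> 1" "u\<^sup>2 < g * f" "g * f < (u + 1)\<^sup>2" by (rule floor_sqrt)
  have *: "(2 * (u + 1))\<^sup>2 - 2\<^sup>2 * (g * f) = 4 * ((u + 1)\<^sup>2 - g * f)"
    by (simp add: power2_eq_square algebra_simps)
  have "0 < 2 * (u + 1)" "2\<^sup>2 * (g * f) < (2 * (u + 1))\<^sup>2" "4 dvd (2 * (u + 1))\<^sup>2 - 2\<^sup>2 * (g * f)"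
    using u * by simp_all
  note m = this
  have mem: "(g * f, 0, 0, 2) \<in> {(e * f, 2, 0 :: int, 0 :: int), (g * e, 0, 2, 0), (g * f, 0, 0, 2)}" by simp
  obtain a b c d where abcd: "\<forall>i<r. R (a i) (b i) (c i) (d i)"
    and eqs: "2 * (quad r A a + e * f * quad r A b + g * e * quad r A c + g * f * quad r A d) = 2\<^sup>2 * (2 * (u + 1))"
      "2 * (polar r A a b + g * polar r A c d) = 2\<^sup>2 * 0" "2 * (polar r A a c + f * polar r A b d) = 2\<^sup>2 * 0" "2 * (polar r A a d + e * polar r A b c) = 2\<^sup>2 * 2"
    by (rule representation_single[OF R mem m])
  then show ?thesis by (intro that[OF u, of a b c d]) simp_all
qed

lemma representation_odd:
  assumes R: "integral_coordinates K R" and gf: "(g * f) mod 4 = 1"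
  obtains T and a b c d :: "nat \<Rightarrow> int" where "T \<ge> 3" "(T - 2)\<^sup>2 < g * f" "g * f < T\<^sup>2"
    "\<And>i. i < r \<Longrightarrow> R (a i) (b i) (c i) (d i)"
    "2 * (quad r A a + e * f * quad r A b + g * e * quad r A c + g * f * quad r A d) = K\<^sup>2 * T"
    "2 * (polar r A a d + e * polar r A b c) = K\<^sup>2"
proof -
  obtain u where u: "u \<ge> 1" "u\<^sup>2 < g * f" "g * f < (u + 1)\<^sup>2" by (rule floor_sqrt)
  \<comment> \<open>The least odd integer above sqrt(gf); odd because (T + sqrt(gf)) / 2 has to be
    integral.\<close>
  define T where "T = (if even u then u + 1 else u + 2)"
  have "odd T" by (simp add: T_def)
  have T: "T \<ge> 3" "(T - 2)\<^sup>2 < g * f" "g * f < T\<^sup>2"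
  proof -
    show "T \<ge> 3" using u(1) by (auto simp: T_def elim!: evenE)
    have "(T - 2)\<^sup>2 \<le> u\<^sup>2" using u(1) by (intro power_mono) (auto simp: T_def)
    then show "(T - 2)\<^sup>2 < g * f" using u(2) by simp
    have "(u + 1)\<^sup>2 \<le> T\<^sup>2" using u(1) by (intro power_mono) (auto simp: T_def)
    then show "g * f < T\<^sup>2" using u(3) by simp
  qed
  obtain s where "T = 2 * s + 1" using \<open>odd T\<close> by (rule oddE)
  moreover obtain h where "g * f = 4 * h + 1" by (metis gf mult_div_mod_eq)
  ultimately have "T\<^sup>2 - 1\<^sup>2 * (g * f) = 4 * (s\<^sup>2 + s - h)"
    by (simp add: power2_eq_square algebra_simps)
  then have "4 dvd T\<^sup>2 - 1\<^sup>2 * (g * f)" by simp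
  moreover have "0 < T" "1\<^sup>2 * (g * f) < T\<^sup>2" using T by simp_all
  ultimately have m: "0 < T" "1\<^sup>2 * (g * f) < T\<^sup>2" "4 dvd T\<^sup>2 - 1\<^sup>2 * (g * f)" by blast+
  have mem: "(g * f, 0, 0, 1) \<in> {(e * f, 1, 0 :: int, 0 :: int), (g * e, 0, 1, 0), (g * f, 0, 0, 1)}" by simp
  obtain a b c d where abcd: "\<forall>i<r. R (a i) (b i) (c i) (d i)"
    and eqs: "2 * (quad r A a + e * f * quad r A b + g * e * quad r A c + g * f * quad r A d) = K\<^sup>2 * T"
      "2 * (polar r A a b + g * polar r A c d) = K\<^sup>2 * 0" "2 * (polar r A a c + f * polar r A b d) = K\<^sup>2 * 0" "2 * (polar r A a d + e * polar r A b c) = K\<^sup>2 * 1"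
    by (rule representation_single[OF R mem m])
  then show ?thesis by (intro that[OF T, of a b c d]) simp_all
qed

text \<open>The budget inequality. It is applied with 0 for an arbitrary vector, 1 for a nonzero one
  and 4 for a nonzero even one.\<close>

lemma weighted_sum_mono:
  fixes a b c d :: "nat \<Rightarrow> int"
  assumes "quad r A a + e * f * quad r A b + g * e * quad r A c + g * f * quad r A d = S"
    and "a' \<le> quad r A a" "b' \<le> quad r A b" "c' \<le> quad r A c" "d' \<le> quad r A d"
  shows "a' + b' * (e * f) + c' * (g * e) + d' * (g * f) \<le> S"
proof -
  have "b' * (e * f) \<le> e * f * quad r A b" "c' * (g * e) \<le> g * e * quad r A c"
    "d' * (g * f) \<le> g * f * quad r A d"
    unfolding mult.commute[of _ "_ * _"] using pos assms(3-5) by simp_all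
  with assms(1,2) show ?thesis by linarith
qed

lemma quad_even_ge:
  assumes "\<And>i. i < r \<Longrightarrow> even (u i :: int)" "quad r A u \<noteq> 0"
  shows "quad r A u \<ge> 4"
  using quad_even[OF assms(1)] assms(2) by force

lemma quad_ge_1: "quad r A u \<noteq> 0 \<Longrightarrow> quad r A u \<ge> (1 :: int)"
  using quad_nonneg[of u] by linarith

text \<open>From ef = gf + (e - g) f one gets ef >= u^2 + 8, and 4u + 4 <= u^2 + 7 unless u = 2.
  That value misses by one and is settled by ef >= 18.\<close>

lemma large_bound:
  assumes "7 \<le> (e - g) * f" "6 \<le> f" "e \<ge> 3" "u\<^sup>2 < g * f"
  shows "4 * (u + 1) < e * f"
proof (cases "u = 2")
  case True
  have "3 * 6 \<le> e * f" using assms by (intro mult_mono) auto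
  then show ?thesis using True by simp
next
  case False
  then have "(u - 2)\<^sup>2 > 0" by simp
  then have "4 * u < u\<^sup>2 + 4" by (simp add: power2_eq_square algebra_simps)
  then show ?thesis using assms by (simp add: algebra_simps)
qed

lemma small_square: "u \<ge> 1 \<Longrightarrow> u\<^sup>2 < g * f \<Longrightarrow> u < g * f"
  using self_le_power[of u 2] by simp

text \<open>Parity pairs (a,b) and (c,d). First b = 0, either since ef exceeds the budget or since b
  is even; hence a is even and costs 4. If c = 0, then d is even and costs 4gf, which is too much;
  otherwise c and d together are too dear.\<close>

lemma contradiction_ef:
  assumes R: "integral_coordinates 2 R" "\<And>m n k l. R m n k l \<Longrightarrow> even (m - n) \<and> even (k - l)"
    and large: "7 \<le> (e - g) * f \<and> 6 \<le> f \<or> (\<forall>m n k l. R m n k l \<longrightarrow> even n)"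
    and e: "3 \<le> e" and gf: "6 \<le> g * f"
  shows False
proof -
  obtain u a b c d where u: "u \<ge> 1" "u\<^sup>2 < g * f" "g * f < (u + 1)\<^sup>2"
    and abcd: "\<And>i. i < r \<Longrightarrow> R (a i) (b i) (c i) (d i)"
    and sum: "quad r A a + e * f * quad r A b + g * e * quad r A c + g * f * quad r A d = 4 * (u + 1)"
    and pol: "polar r A a d + e * polar r A b c = 4"
    by (rule representation_ceiling[OF R(1)]) blast
  note mono = weighted_sum_mono[OF sum]
  have b: "quad r A b = 0"
  proof (rule ccontr)
    assume b: "quad r A b \<noteq> 0"
    from large show False
    proof
      assume "7 \<le> (e - g) * f \<and> 6 \<le> f"
      then have "4 * (u + 1) < e * f" using large_bound e u(2) by blast
      moreover have "e * f \<le> 4 * (u + 1)"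
        using mono[of 0 1 0 0] quad_ge_1[OF b] by (simp add: quad_nonneg)
      ultimately show False by linarith
    next
      assume "\<forall>m n k l. R m n k l \<longrightarrow> even n"
      then have "4 \<le> quad r A b" using abcd b by (intro quad_even_ge) blast+
      then have "e * f \<le> u + 1" using mono[of 0 4 0 0] by (simp add: quad_nonneg)
      then show False using small_square[OF u(1,2)] bounds(4) by linarith
    qed
  qed
  have a_even: "even (a i)" if "i < r" for i
    using R(2)[OF abcd[OF that]] quad_eq_0D[OF b that] by simp
  have "polar r A a d = 4" using pol polar_eq_0(1)[OF b] by simp
  then have "quad r A a \<noteq> 0" and d: "quad r A d \<noteq> 0" using polar_eq_0 by force+
  then have a4: "4 \<le> quad r A a" using a_even by (intro quad_even_ge)
  show False
  proof (cases "quad r A c = 0")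
    case True
    have "even (d i)" if "i < r" for i
      using R(2)[OF abcd[OF that]] quad_eq_0D[OF True that] by simp
    then have "4 \<le> quad r A d" using d by (intro quad_even_ge)
    then have "4 + 4 * (g * f) \<le> 4 * (u + 1)" using mono[of 4 0 0 4] a4 by (simp add: quad_nonneg)
    then show False using small_square[OF u(1,2)] by simp
  next
    case False
    have "4 + g * e + g * f \<le> 4 * (u + 1)"
      using mono[of 4 0 1 1] a4 quad_ge_1[OF d] quad_ge_1[OF False] by (simp add: quad_nonneg)
    \<comment> \<open>The remaining inequalities leave only u = 2 and gf = 5, which
      \<open>gf\<close> excludes.\<close>
    moreover have "3 \<le> g * e" using bounds e by linarith
    ultimately have "g * f \<le> 4 * u - 3" by simp
    moreover have "0 \<le> (u - 2)\<^sup>2" by simp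
    then have "4 * u - 4 \<le> u\<^sup>2" by (simp add: power2_eq_square algebra_simps)
    ultimately have "u\<^sup>2 = 4 * u - 4" "g * f = 4 * u - 3" using u(2) by linarith+
    then have "(u - 2)\<^sup>2 = 0" by (simp add: power2_eq_square algebra_simps)
    then show False using \<open>g * f = 4 * u - 3\<close> gf by simp
  qed
qed

text \<open>Parity pair (b,d): b is too dear, so d is even, and 4gf exceeds the budget.\<close>

lemma contradiction_ge:
  assumes R: "integral_coordinates 2 R" "\<And>m n k l. R m n k l \<Longrightarrow> even (l - n)"
    and large: "7 \<le> (e - g) * f" "6 \<le> f" "3 \<le> e"
  shows False
proof -
  obtain u a b c d where u: "u \<ge> 1" "u\<^sup>2 < g * f" "g * f < (u + 1)\<^sup>2"
    and abcd: "\<And>i. i < r \<Longrightarrow> R (a i) (b i) (c i) (d i)"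
    and sum: "quad r A a + e * f * quad r A b + g * e * quad r A c + g * f * quad r A d = 4 * (u + 1)"
    and pol: "polar r A a d + e * polar r A b c = 4"
    by (rule representation_ceiling[OF R(1)]) blast
  note mono = weighted_sum_mono[OF sum]
  have b: "quad r A b = 0"
  proof (rule ccontr)
    assume "quad r A b \<noteq> 0"
    then have "e * f \<le> 4 * (u + 1)" using mono[of 0 1 0 0] quad_ge_1[of b] by (simp add: quad_nonneg)
    then show False using large_bound[OF large u(2)] by linarith
  qed
  have d_even: "even (d i)" if "i < r" for i
    using R(2)[OF abcd[OF that]] quad_eq_0D[OF b that] by simp
  have "polar r A a d = 4" using pol polar_eq_0(1)[OF b] by simp
  then have "quad r A a \<noteq> 0" "quad r A d \<noteq> 0" using polar_eq_0 by force+
  then have a1: "1 \<le> quad r A a" and "4 \<le> quad r A d"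
    using d_even by (auto intro: quad_even_ge quad_ge_1)
  then have "1 + 4 * (g * f) \<le> 4 * (u + 1)" using mono[of 1 0 0 4] a1 by (simp add: quad_nonneg)
  then show False using small_square[OF u(1,2)] by simp
qed

text \<open>As d is even, it is too dear and vanishes, so b and c are nonzero and e (f + g) <= 4 (u
  + 1), whereas f + g > 2u. For e >= 6 this is absurd, and e = 2 leaves only (1, 2, 3).\<close>

lemma contradiction_gf_3_mod_4:
  assumes R: "integral_coordinates 2 R" "\<And>m n k l. R m n k l \<Longrightarrow> even l"
    and e: "e mod 4 = 2" and gf: "(g * f) mod 4 = 3" and ne: "\<not> (g = 1 \<and> e = 2 \<and> f = 3)"
  shows False
proof -
  obtain u a b c d where u: "u \<ge> 1" "u\<^sup>2 < g * f" "g * f < (u + 1)\<^sup>2"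
    and abcd: "\<And>i. i < r \<Longrightarrow> R (a i) (b i) (c i) (d i)"
    and sum: "quad r A a + e * f * quad r A b + g * e * quad r A c + g * f * quad r A d = 4 * (u + 1)"
    and pol: "polar r A a d + e * polar r A b c = 4"
    by (rule representation_ceiling[OF R(1)]) blast
  note mono = weighted_sum_mono[OF sum]
  have d: "quad r A d = 0"
  proof (rule ccontr)
    assume d: "quad r A d \<noteq> 0"
    have "4 \<le> quad r A d" using R(2)[OF abcd] d by (intro quad_even_ge) blast
    then have "g * f \<le> u + 1" using mono[of 0 0 0 4] by (simp add: quad_nonneg)
    then have "u\<^sup>2 \<le> u" using u(2) by linarith
    then have "u = 1" using u(1) by (simp add: power2_eq_square mult_le_cancel_left1)
    then have "g * f \<le> 2" using \<open>g * f \<le> u + 1\<close> by simp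
    then show False using bounds by linarith
  qed
  then have "e * polar r A b c = 4" using pol polar_eq_0(2)[OF d] by simp
  then have bc: "quad r A b \<noteq> 0" "quad r A c \<noteq> 0" using polar_eq_0 by force+
  have "e * f + g * e \<le> 4 * (u + 1)"
    using mono[of 0 1 1 0] bc[THEN quad_ge_1] by (simp add: quad_nonneg)
  then have le: "e * (f + g) \<le> 4 * (u + 1)" by (simp add: algebra_simps)
  have "0 \<le> (f - g)\<^sup>2" by simp
  then have "4 * (g * f) \<le> (f + g)\<^sup>2" by (simp add: power2_eq_square algebra_simps)
  then have "(2 * u)\<^sup>2 < (f + g)\<^sup>2" using u(2) by (simp add: power_mult_distrib)
  then have ge: "2 * u < f + g" by (rule power2_less_imp_less) (use pos in simp)
  show False
  proof (cases "e = 2")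
    case True
    then have g: "g = 1" using bounds sorted by linarith
    have f: "f \<le> 2 * u + 1" using le True g by simp
    then have "u * u \<le> 2 * u" using u(2) g by (simp add: power2_eq_square)
    then have "u \<le> 2" using u(1) by (simp add: mult_le_cancel_right)
    then have "f \<le> 5" using f by simp
    moreover have "f mod 4 = 3" using gf g by simp
    ultimately have "f = 3" using bounds(3) by presburger
    then show False using ne g True by simp
  next
    case False
    then have "6 \<le> e" using e bounds(2) by presburger
    then have "6 * (f + g) \<le> e * (f + g)" using pos by (intro mult_right_mono) auto
    from order_trans[OF this le] show False using ge u(1) by simp
  qed
qed

lemma contradiction_gf_1_mod_4:
  assumes R: "integral_coordinates 2 R" and gf: "(g * f) mod 4 = 1" "10 < g * f"
  shows False
proof -
  obtain T a b c d where T: "T \<ge> 3" "(T - 2)\<^sup>2 < g * f" "g * f < T\<^sup>2"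
    and sum2: "2 * (quad r A a + e * f * quad r A b + g * e * quad r A c + g * f * quad r A d) = 2\<^sup>2 * T"
    and pol: "2 * (polar r A a d + e * polar r A b c) = 2\<^sup>2"
    by (rule representation_odd[OF R gf(1)]) blast
  have sum: "quad r A a + e * f * quad r A b + g * e * quad r A c + g * f * quad r A d = 2 * T"
    using sum2 by simp
  note mono = weighted_sum_mono[OF sum]
  have d: "quad r A d = 0"
  proof (rule ccontr)
    assume "quad r A d \<noteq> 0"
    then have *: "g * f \<le> 2 * T" using mono[of 0 0 0 1] quad_ge_1[of d] by (simp add: quad_nonneg)
    then have "(T - 3) * (T - 3) < 3 * 3" using T(2) by (simp add: power2_eq_square algebra_simps)
    then have "T - 3 < 3" using mult_mono[of 3 "T - 3" 3 "T - 3"] by linarith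
    then show False using * gf(2) by simp
  qed
  then have "e * polar r A b c = 2" using pol polar_eq_0(2)[OF d] by simp
  then have bc: "quad r A b \<noteq> 0" "quad r A c \<noteq> 0" using polar_eq_0 by force+
  have "e * f + g * e \<le> 2 * T"
    using mono[of 0 1 1 0] bc[THEN quad_ge_1] by (simp add: quad_nonneg)
  then have le: "e * (f + g) \<le> 2 * T" by (simp add: algebra_simps)
  have "0 \<le> (f - g)\<^sup>2" by simp
  then have "4 * (g * f) \<le> (f + g)\<^sup>2" by (simp add: power2_eq_square algebra_simps)
  then have "(2 * (T - 2))\<^sup>2 < (f + g)\<^sup>2" using T(2) by (simp only: power_mult_distrib) simp
  then have ge: "2 * (T - 2) < f + g" by (rule power2_less_imp_less) (use pos in simp)
  have "2 * (f + g) \<le> e * (f + g)" using bounds pos by (intro mult_right_mono) auto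
  from order_trans[OF this le] have "T = 3" using ge T(1) by simp
  then show False using T(3) gf(2) by simp
qed

text \<open>The element 2 + sqrt(e) is not represented.\<close>

lemma contradiction_sqrt5:
  assumes R: "integral_coordinates 2 R" "\<And>m n k l. R m n k l \<Longrightarrow> even (n - k)"
    and g: "g = 1" and f: "f = 5"
  shows False
proof -
  have "e \<noteq> 4" using not_square_dvd(2)[of 2] by auto
  \<comment> \<open>Hence ef >= 10 exceeds the budget 8, which eliminates b.\<close>
  then have e: "e = 2 \<or> e = 3" using bounds sorted f by linarith
  have "(0::int) < 4" "2\<^sup>2 * (g * e) < 4\<^sup>2" "4 dvd 4\<^sup>2 - 2\<^sup>2 * (g * e)" using e g by auto
  note m = this
  have mem: "(g * e, 0, 2, 0) \<in> {(e * f, 2, 0 :: int, 0 :: int), (g * e, 0, 2, 0), (g * f, 0, 0, 2)}" by simp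
  obtain a b c d where abcd: "\<forall>i<r. R (a i) (b i) (c i) (d i)"
    and eqs: "2 * (quad r A a + e * f * quad r A b + g * e * quad r A c + g * f * quad r A d) = 2\<^sup>2 * 4"
      "2 * (polar r A a b + g * polar r A c d) = 2\<^sup>2 * 0" "2 * (polar r A a c + f * polar r A b d) = 2\<^sup>2 * 2" "2 * (polar r A a d + e * polar r A b c) = 2\<^sup>2 * 0"
    by (rule representation_single[OF R(1) mem m])
  note abcd = abcd[rule_format]
  from eqs have sum: "quad r A a + e * f * quad r A b + g * e * quad r A c + g * f * quad r A d = 8"
    and pol: "polar r A a c + f * polar r A b d = 4"
    by simp_all
  note mono = weighted_sum_mono[OF sum]
  have b: "quad r A b = 0"
  proof (rule ccontr)
    assume "quad r A b \<noteq> 0"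
    then have "e * f \<le> 8" using mono[of 0 1 0 0] quad_ge_1[of b] by (simp add: quad_nonneg)
    then show False using e f by auto
  qed
  have c_even: "even (c i)" if "i < r" for i
    using R(2)[OF abcd[OF that]] quad_eq_0D[OF b that] by simp
  have "polar r A a c = 4" using pol polar_eq_0(1)[OF b] by simp
  then have "quad r A a \<noteq> 0" and c: "quad r A c \<noteq> 0" using polar_eq_0 by force+
  then have "1 \<le> quad r A a" by (intro quad_ge_1)
  moreover have "4 \<le> quad r A c" using c_even c by (intro quad_even_ge)
  ultimately have "1 + 4 * (g * e) \<le> 8" using mono[of 1 0 4 0] by (simp add: quad_nonneg)
  then show False using e g by auto
qed

text \<open>The element 3 + sqrt 6 is not represented: it would force orthogonal b and c with
  Q(b) = Q(c) = 1 and b + c even, hence Q(b + c) = 2, which is not divisible by 4.\<close>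

lemma contradiction_sqrt2_sqrt3:
  assumes R: "integral_coordinates 2 R" "\<And>m n k l. R m n k l \<Longrightarrow> even m \<and> even l \<and> even (n - k)"
    and gef: "g = 1" "e = 2" "f = 3"
  shows False
proof -
  have "(0::int) < 6" "2\<^sup>2 * (e * f) < 6\<^sup>2" "4 dvd 6\<^sup>2 - 2\<^sup>2 * (e * f)" using gef by auto
  note m = this
  have mem: "(e * f, 2, 0, 0) \<in> {(e * f, 2, 0 :: int, 0 :: int), (g * e, 0, 2, 0), (g * f, 0, 0, 2)}" by simp
  obtain a b c d where abcd: "\<forall>i<r. R (a i) (b i) (c i) (d i)"
    and eqs: "2 * (quad r A a + e * f * quad r A b + g * e * quad r A c + g * f * quad r A d) = 2\<^sup>2 * 6"
      "2 * (polar r A a b + g * polar r A c d) = 2\<^sup>2 * 2" "2 * (polar r A a c + f * polar r A b d) = 2\<^sup>2 * 0" "2 * (polar r A a d + e * polar r A b c) = 2\<^sup>2 * 0"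
    by (rule representation_single[OF R(1) mem m])
  note abcd = abcd[rule_format]
  from eqs have sum: "quad r A a + 6 * quad r A b + 2 * quad r A c + 3 * quad r A d = 12"
    and pol1: "polar r A a b + polar r A c d = 4"
    and pol3: "polar r A a d + 2 * polar r A b c = 0"
    by (simp_all add: gef)
  have nn: "0 \<le> quad r A a" "0 \<le> quad r A b" "0 \<le> quad r A c" "0 \<le> quad r A d"
    by (rule quad_nonneg)+
  have even: "even (a i)" "even (d i)" "even (b i + c i)" if "i < r" for i
    using R(2)[OF abcd[OF that]] by simp_all
  have d: "quad r A d = 0"
  proof (rule ccontr)
    assume d: "quad r A d \<noteq> 0"
    \<comment> \<open>An even nonzero d would use up the whole budget 12.\<close>
    then have "4 \<le> quad r A d" using even(2) by (intro quad_even_ge)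
    then have "quad r A a = 0" "quad r A c = 0" using sum nn by linarith+
    then show False using pol1 polar_eq_0(1) by simp
  qed
  have "polar r A a b = 4" using pol1 polar_eq_0(2)[OF d] by simp
  then have a0: "quad r A a \<noteq> 0" and b0: "quad r A b \<noteq> 0" using polar_eq_0 by force+
  have a: "4 \<le> quad r A a" using even(1) a0 by (intro quad_even_ge)
  have b: "1 \<le> quad r A b" by (intro quad_ge_1 b0)
  have c0: "quad r A c \<noteq> 0"
  proof
    assume c: "quad r A c = 0"
    have "even (b i)" if "i < r" for i using even(3)[OF that] quad_eq_0D[OF c that] by simp
    then have "4 \<le> quad r A b" using b0 by (intro quad_even_ge)
    then show False using sum nn by linarith
  qed
  then have c: "1 \<le> quad r A c" by (rule quad_ge_1)
  have "polar r A b c = 0" using pol3 polar_eq_0(2)[OF d] by simp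
  \<comment> \<open>The minimal prices 4, 6 and 2 of a, b, c add up to exactly 12, so Q(b) = Q(c) =
    1.\<close>
  then have bc: "quad r A (\<lambda>i. b i + c i) = 2"
    using sum nn a b c unfolding quad_add by linarith
  then show False using quad_even_ge[of "\<lambda>i. b i + c i"] even(3) by simp
qed

text \<open>The budget is 8T because K = 4. It excludes b, so a is even and with it d; then 4gf <=
  8T gives T <= 5 and gf <= 10, against f >= 11.\<close>

lemma contradiction_all_1_mod_4:
  assumes R: "integral_coordinates 4 R"
      "\<And>m n k l. R m n k l \<Longrightarrow> even (m - n) \<and> even (m - l)"
    and gf: "(g * f) mod 4 = 1" and e: "g + 4 \<le> e" and f: "11 \<le> f"
  shows False
proof -
  obtain T a b c d where T: "T \<ge> 3" "(T - 2)\<^sup>2 < g * f" "g * f < T\<^sup>2"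
    and abcd: "\<And>i. i < r \<Longrightarrow> R (a i) (b i) (c i) (d i)"
    and sum2: "2 * (quad r A a + e * f * quad r A b + g * e * quad r A c + g * f * quad r A d) = 4\<^sup>2 * T"
    and pol: "2 * (polar r A a d + e * polar r A b c) = 4\<^sup>2"
    by (rule representation_odd[OF R(1) gf]) blast
  have sum: "quad r A a + e * f * quad r A b + g * e * quad r A c + g * f * quad r A d = 8 * T"
    using sum2 by simp
  note mono = weighted_sum_mono[OF sum]
  have b: "quad r A b = 0"
  proof (rule ccontr)
    assume "quad r A b \<noteq> 0"
    then have ef: "e * f \<le> 8 * T" using mono[of 0 1 0 0] quad_ge_1[of b] by (simp add: quad_nonneg)
    \<comment> \<open>T = 10 minimises (T - 2)^2 - 16T, with value -96; the lower bound 99 + gf for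
      2ef beats this.\<close>
    have "0 \<le> (T - 10)\<^sup>2" by simp
    then have "16 * T \<le> (T - 2)\<^sup>2 + 96" by (simp add: power2_eq_square algebra_simps)
    moreover have "9 * 11 \<le> (2 * e - g) * f" using e f pos by (intro mult_mono) auto
    then have "99 + g * f \<le> 2 * (e * f)" by (simp add: algebra_simps)
    ultimately show False using ef T(2) by linarith
  qed
  have d_even: "even (d i)" if "i < r" for i
    using R(2)[OF abcd[OF that]] quad_eq_0D[OF b that] by auto
  have "polar r A a d = 8" using pol polar_eq_0(1)[OF b] by simp
  then have "quad r A d \<noteq> 0" using polar_eq_0 by force
  then have "4 \<le> quad r A d" using d_even by (intro quad_even_ge)
  then have *: "g * f \<le> 2 * T" using mono[of 0 0 0 4] by (simp add: quad_nonneg mult.commute[of g f])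
  then have "(T - 3) * (T - 3) < 3 * 3" using T(2) by (simp add: power2_eq_square algebra_simps)
  then have "T - 3 < 3" using mult_mono[of 3 "T - 3" 3 "T - 3"] by linarith
  then show False using * bounds(6) f by linarith
qed

end

section \<open>Conclusion\<close>

lemma mod_4_product_eq_one_iff:
  fixes e f :: int
  shows "(e * f) mod 4 = 1 \<longleftrightarrow> odd e \<and> e mod 4 = f mod 4"
proof
  assume "(e * f) mod 4 = 1"
  then show "odd e \<and> e mod 4 = f mod 4" using mod_4_product_one by blast
next
  assume *: "odd e \<and> e mod 4 = f mod 4"
  then have "e mod 4 = 1 \<or> e mod 4 = 3" by presburger
  moreover have "(e * f) mod 4 = ((e mod 4) * (f mod 4)) mod 4" by (simp add: mod_mult_eq)
  ultimately show "(e * f) mod 4 = 1" using * by auto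
qed

lemma mod_4_gap: "(a :: int) mod 4 = b mod 4 \<Longrightarrow> a < b \<Longrightarrow> a + 4 \<le> b"
  by presburger

lemma odd_mod_4: "odd (n :: int) \<Longrightarrow> n mod 4 \<noteq> 1 \<Longrightarrow> n mod 4 = 3"
  by presburger

section \<open>Parities and contradictions in each residue class\<close>

context sorted_form
begin

lemma integral_coordinatesI:
  assumes "K > 0" and "\<And>a b c d. a \<in> \<rat> \<Longrightarrow> b \<in> \<rat> \<Longrightarrow> c \<in> \<rat> \<Longrightarrow> d \<in> \<rat> \<Longrightarrow>
    algebraic_int (surd a b c d x y z) \<Longrightarrow>
    \<exists>m n k l :: int. surd a b c d x y z = surd (m / K) (n / K) (k / K) (l / K) x y z \<and> R m n k l"
  shows "integral_coordinates K R"
  using assms unfolding integral_coordinates_def by blast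

lemma coordinates_ef_1:
  assumes "(e * f) mod 4 = 1" "(g * e) mod 4 \<noteq> 1" "(g * f) mod 4 \<noteq> 1"
  shows "integral_coordinates 2 (\<lambda>m n k l. even (m - n) \<and> even (k - l))"
  using half_integers_1[OF xyz _ _ _ _ _ assms] by (intro integral_coordinatesI) auto

lemma coordinates_ef_3:
  assumes "(e * f) mod 4 = 3" "even g"
  shows "integral_coordinates 2 (\<lambda>m n k l. even m \<and> even n \<and> even (k - l))"
  using half_integers_3[OF xyz _ _ _ _ _ assms] by (intro integral_coordinatesI) auto

lemma coordinates_all_1:
  assumes "(e * f) mod 4 = 1" "(g * e) mod 4 = 1" "(g * f) mod 4 = 1"
  shows "integral_coordinates 4 (\<lambda>m n k l. even (m - n) \<and> even (m - k) \<and> even (m - l))"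
  using quarter_integers[OF xyz _ _ _ _ _ assms] by (intro integral_coordinatesI) auto

text \<open>Rotating (g, e, f) fixes the rational coordinate and permutes the others cyclically;
  \<open>R\<close> is transported accordingly.\<close>

lemma integral_coordinates_rotate:
  assumes "K > 0" and "\<And>a b c d. a \<in> \<rat> \<Longrightarrow> b \<in> \<rat> \<Longrightarrow> c \<in> \<rat> \<Longrightarrow> d \<in> \<rat> \<Longrightarrow>
    algebraic_int (surd a b c d z x y) \<Longrightarrow>
    \<exists>m n k l :: int. surd a b c d z x y = surd (m / K) (n / K) (k / K) (l / K) z x y \<and> R m n k l"
  shows "integral_coordinates K (\<lambda>m n k l. R m k l n)"
proof (rule integral_coordinatesI[OF assms(1)])
  fix a b c d :: real assume "a \<in> \<rat>" "b \<in> \<rat>" "c \<in> \<rat>" "d \<in> \<rat>" "algebraic_int (surd a b c d x y z)"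
  then show "\<exists>m n k l :: int. surd a b c d x y z = surd (m / K) (n / K) (k / K) (l / K) x y z \<and> R m k l n"
    using assms(2)[of a c d b] unfolding surd_rotate[of _ _ _ _ x y z] by blast
qed

lemma integral_coordinates_rotate2:
  assumes "K > 0" and "\<And>a b c d. a \<in> \<rat> \<Longrightarrow> b \<in> \<rat> \<Longrightarrow> c \<in> \<rat> \<Longrightarrow> d \<in> \<rat> \<Longrightarrow>
    algebraic_int (surd a b c d y z x) \<Longrightarrow>
    \<exists>m n k l :: int. surd a b c d y z x = surd (m / K) (n / K) (k / K) (l / K) y z x \<and> R m n k l"
  shows "integral_coordinates K (\<lambda>m n k l. R m l n k)"
proof (rule integral_coordinates_rotate[OF assms(1)])
  fix a b c d :: real assume "a \<in> \<rat>" "b \<in> \<rat>" "c \<in> \<rat>" "d \<in> \<rat>" "algebraic_int (surd a b c d z x y)"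
  then show "\<exists>m n k l :: int. surd a b c d z x y = surd (m / K) (n / K) (k / K) (l / K) z x y \<and> R m k l n"
    using assms(2)[of a c d b] unfolding surd_rotate[of _ _ _ _ z x y] by blast
qed

interpretation r1: surd_triple f g e by (rule rotate)
interpretation r2: surd_triple e f g by (rule r1.rotate)

lemma coordinates_ge_1:
  assumes "(g * e) mod 4 = 1" "(f * g) mod 4 \<noteq> 1" "(f * e) mod 4 \<noteq> 1"
  shows "integral_coordinates 2 (\<lambda>m n k l. even (m - k) \<and> even (l - n))"
  by (rule integral_coordinates_rotate)
    (use r1.half_integers_1[OF xyz(3,1,2) _ _ _ _ _ assms] in auto)

lemma coordinates_ge_3:
  assumes "(g * e) mod 4 = 3" "even f"
  shows "integral_coordinates 2 (\<lambda>m n k l. even m \<and> even k \<and> even (l - n))"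
  by (rule integral_coordinates_rotate)
    (use r1.half_integers_3[OF xyz(3,1,2) _ _ _ _ _ assms] in auto)

lemma coordinates_gf_1:
  assumes "(f * g) mod 4 = 1" "(e * f) mod 4 \<noteq> 1" "(e * g) mod 4 \<noteq> 1"
  shows "integral_coordinates 2 (\<lambda>m n k l. even (m - l) \<and> even (n - k))"
  by (rule integral_coordinates_rotate2)
    (use r2.half_integers_1[OF xyz(2,3,1) _ _ _ _ _ assms] in auto)

lemma coordinates_gf_3:
  assumes "(f * g) mod 4 = 3" "even e"
  shows "integral_coordinates 2 (\<lambda>m n k l. even m \<and> even l \<and> even (n - k))"
  by (rule integral_coordinates_rotate2)
    (use r2.half_integers_3[OF xyz(2,3,1) _ _ _ _ _ assms] in auto)

lemma one_even: "odd g \<or> odd e" "odd g \<or> odd f" "odd e \<or> odd f"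
proof -
  have "\<not> (even a \<and> even b)" if "\<not> 2\<^sup>2 dvd a * b" for a b :: int
    using that mult_dvd_mono[of 2 a 2 b] by (auto simp: power2_eq_square)
  then show "odd g \<or> odd e" "odd g \<or> odd f" "odd e \<or> odd f"
    using not_square_dvd[of 2] by auto
qed

lemma factor_mod_4: "e mod 4 \<noteq> 0" "f mod 4 \<noteq> 0"
  using not_square_dvd(1)[of 2] by (auto simp: mod_eq_0_iff_dvd)

lemma contradiction: False
proof -
  note iff = mod_4_product_eq_one_iff
  have large: "7 \<le> (e - g) * f" if "k \<le> e - g" "l \<le> f" "0 \<le> l" "7 \<le> k * l" for k l
  proof -
    have "k * l \<le> (e - g) * f"
      using sorted that by (intro mult_mono) auto
    with that(4) show ?thesis by linarith
  qed
  consider (all) "(e * f) mod 4 = 1" "(g * e) mod 4 = 1" "(g * f) mod 4 = 1"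
    | (D1) "(e * f) mod 4 = 1" "(g * e) mod 4 \<noteq> 1" "(g * f) mod 4 \<noteq> 1"
    | (E1) "(g * e) mod 4 = 1" "(g * f) mod 4 \<noteq> 1" "(e * f) mod 4 \<noteq> 1"
    | (F1) "(g * f) mod 4 = 1" "(e * f) mod 4 \<noteq> 1" "(g * e) mod 4 \<noteq> 1"
    | (none) "(e * f) mod 4 \<noteq> 1" "(g * e) mod 4 \<noteq> 1" "(g * f) mod 4 \<noteq> 1"
    unfolding iff by atomize_elim presburger
  then show False
  proof cases
    case all
    then have "odd e" and ef: "e mod 4 = f mod 4" and "g mod 4 = e mod 4" unfolding iff by auto
    then have e: "g + 4 \<le> e" and "e + 4 \<le> f" using mod_4_gap sorted by blast+
    then have "9 \<le> f" using bounds(1) by linarith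
    \<comment> \<open>Three numbers congruent mod 4 give f >= 9; squarefreeness excludes 9 and
      oddness excludes 10.\<close>
    moreover have "f \<noteq> 9" using not_square_dvd(1)[of 3] by auto
    moreover have "odd f" using \<open>odd e\<close> ef by presburger
    then have "f \<noteq> 10" by auto
    ultimately have f: "11 \<le> f" by linarith
    show False by (rule contradiction_all_1_mod_4[OF coordinates_all_1[OF all] _ all(3) e f]) blast
  next
    case D1
    then have "odd e" "e + 4 \<le> f" unfolding iff using mod_4_gap sorted by blast+
    moreover from this have "e \<noteq> 2" by auto
    ultimately have e: "3 \<le> e" and f: "7 \<le> f" using bounds(2) by linarith+
    have "6 \<le> g * f" using f bounds(6) by linarith
    then show False
      by (rule contradiction_ef[OF coordinates_ef_1[OF D1] _ _ e, rotated -1])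
        (use large[of 1 7] f sorted in auto)
  next
    case E1
    then have "g + 4 \<le> e" unfolding iff using mod_4_gap sorted by blast
    then have e: "4 \<le> e - g" "5 \<le> e" using bounds(1) by linarith+
    show False
      by (rule contradiction_ge[OF coordinates_ge_1])
        (use E1 large[of 4 6] e sorted in \<open>auto simp: mult.commute\<close>)
  next
    case F1
    have R: "integral_coordinates 2 (\<lambda>m n k l. even (m - l) \<and> even (n - k))"
      by (rule coordinates_gf_1) (use F1 in \<open>auto simp: mult.commute\<close>)
    show False
    proof (cases "10 < g * f")
      case True
      with contradiction_gf_1_mod_4[OF R F1(1)] show False .
    next
      case False
      \<comment> \<open>The values 3 to 10 that are 1 mod 4 are 5 and 9, so gf = 5 remains, with g =
        1 and f = 5.\<close>
      have "g * f \<noteq> 9" using not_square_dvd(3)[of 3] by auto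
      moreover define N where "N = g * f"
      ultimately have "N = 5"
        using False F1(1) bounds(3,6) unfolding N_def[symmetric] by presburger
      moreover have "g = 1"
      proof (rule ccontr)
        assume "g \<noteq> 1"
        then have "2 * 4 \<le> g * f" using bounds(1) sorted by (intro mult_mono) auto
        with \<open>N = 5\<close> show False by (simp add: N_def)
      qed
      ultimately show False using contradiction_sqrt5[OF R] by (simp add: N_def)
    qed
  next
    case none
    \<comment> \<open>Of three odd numbers two agree mod 4, and their product is 1 mod 4.\<close>
    then have "even g \<or> even e \<or> even f" unfolding iff by presburger
    then consider "even g" | "even e" | "even f" by blast
    then show False
    proof cases
      case 1
      then have "odd e" "odd f" using one_even by auto
      then have ef: "(e * f) mod 4 = 3" using none(1) by (intro odd_mod_4) auto
      have e: "3 \<le> e" and g: "2 \<le> g" using \<open>odd e\<close> 1 bounds(1,2) by presburger+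
      have "2 * 3 \<le> g * f" using g bounds(3) by (intro mult_mono) auto
      then show False
        using contradiction_ef[OF coordinates_ef_3[OF ef 1] _ _ e] by auto
    next
      case 2
      then have "odd g" "odd f" using one_even by auto
      then have gf: "(g * f) mod 4 = 3" using none(3) by (intro odd_mod_4) auto
      have e: "e mod 4 = 2" using 2 factor_mod_4(1) by presburger
      have R: "integral_coordinates 2 (\<lambda>m n k l. even m \<and> even l \<and> even (n - k))"
        by (rule coordinates_gf_3) (use gf 2 in \<open>auto simp: mult.commute\<close>)
      show False
      proof (cases "g = 1 \<and> e = 2 \<and> f = 3")
        case True
        then show False using contradiction_sqrt2_sqrt3[OF R] by blast
      next
        case False
        then show False using contradiction_gf_3_mod_4[OF R _ e gf] by blast
      qed
    next
      case 3
      then have "odd g" "odd e" using one_even by auto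
      then have ge: "(g * e) mod 4 = 3" using none(2) by (intro odd_mod_4) auto
      have e: "2 \<le> e - g" "3 \<le> e" using \<open>odd g\<close> \<open>odd e\<close> bounds(1) sorted by presburger+
      have f: "6 \<le> f" using 3 factor_mod_4(2) bounds(3) by presburger
      show False
        by (rule contradiction_ge[OF coordinates_ge_3[OF ge 3]]) (use large[of 2 6] e f in auto)
    qed
  qed
qed

end

section \<open>From arbitrary p and q to a sorted triple\<close>

context universal_form
begin

lemma rotate_form: "universal_form f g e p q z x y r A"
proof -
  interpret r1: surd_triple f g e by (rule rotate)
  have "surd_field z x y = surd_field x y z"
    unfolding surd_field_def surd_rotate[of _ _ _ _ x y z] by blast
  then show ?thesis
    using xyz field universal by unfold_locales simp_all
qed

lemma swap_form: "universal_form g f e p q x z y r A"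
proof -
  interpret r1: surd_triple g f e by (rule swap)
  have "surd_field x z y = surd_field x y z"
    unfolding surd_field_def surd_swap[of _ _ _ _ x y z] by blast
  then show ?thesis
    using xyz field universal by unfold_locales simp_all
qed

end

lemma universal_form_sorted_False:
  assumes "universal_form g e f p q x y z r A" "g < e" "e < f"
  shows False
proof -
  interpret universal_form g e f p q x y z r A by fact
  interpret sorted_form g e f p q x y z r A by unfold_locales fact+
  show False by (rule contradiction)
qed

text \<open>Rotation and one transposition generate all six orders of g, e, f, one of which is
  increasing.\<close>

lemma universal_form_False:
  assumes uf: "universal_form g e f p q x y z r A" and ne: "g \<noteq> e" "e \<noteq> f" "g \<noteq> f"
  shows False
proof -
  note rot = universal_form.rotate_form and sw = universal_form.swap_form
  note uf' = uf rot[OF uf] rot[OF rot[OF uf]] sw[OF uf] sw[OF rot[OF uf]] sw[OF rot[OF rot[OF uf]]]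
  consider "g < e" "e < f" | "f < g" "g < e" | "e < f" "f < g" | "g < f" "f < e" | "f < e" "e < g" | "e < g" "g < f"
    using ne by linarith
  then show False using uf'[THEN universal_form_sorted_False] by cases
qed

text \<open>Since sqrt(mk) sqrt(ml) = m sqrt(kl), the two bases differ by the rational factor m in
  one coordinate.\<close>

lemma biquad_field_eq_surd_field:
  fixes m k l :: int
  assumes "m > 0" "k > 0" "l > 0"
  shows "biquad_field (m * k) (m * l) = surd_field (sqrt m) (sqrt k) (sqrt l)"
proof (intro equalityI subsetI)
  fix w assume "w \<in> biquad_field (m * k) (m * l)"
  then obtain a b c d where "w = of_rat a + of_rat b * sqrt (of_int (m * k)) + of_rat c * sqrt (of_int (m * l))
      + of_rat d * sqrt (of_int (m * k)) * sqrt (of_int (m * l))"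
    unfolding biquad_field_def by blast
  also have "\<dots> = surd (of_rat a) (of_int m * of_rat d) (of_rat b) (of_rat c) (sqrt m) (sqrt k) (sqrt l)"
    using assms by (simp add: surd_def real_sqrt_mult)
  finally show "w \<in> surd_field (sqrt m) (sqrt k) (sqrt l)"
    unfolding surd_field_def by (auto intro!: exI Rats_mult)
next
  fix w assume "w \<in> surd_field (sqrt m) (sqrt k) (sqrt l)"
  then obtain a b c d where "w = surd (of_rat a) (of_rat b) (of_rat c) (of_rat d) (sqrt m) (sqrt k) (sqrt l)"
    unfolding surd_field_def Rats_def by auto
  also have "\<dots> = of_rat a + of_rat c * sqrt (of_int (m * k)) + of_rat d * sqrt (of_int (m * l))
      + of_rat (b / of_int m) * sqrt (of_int (m * k)) * sqrt (of_int (m * l))"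
  proof -
    have "of_rat (b / of_int m) * sqrt (of_int (m * k)) * sqrt (of_int (m * l)) =
        of_rat b / of_int m * (sqrt m * sqrt m) * (sqrt k * sqrt l)"
      by (simp add: real_sqrt_mult of_rat_divide)
    also have "\<dots> = of_rat b * (sqrt k * sqrt l)"
      using assms by simp
    finally show ?thesis by (auto simp: surd_def real_sqrt_mult)
  qed
  finally show "w \<in> biquad_field (m * k) (m * l)"
    unfolding biquad_field_def by blast
qed

lemma squarefree_mult_imp_coprime:
  fixes a b :: int
  assumes "squarefree (a * b)"
  shows "coprime a b"
proof (rule coprimeI)
  fix d assume "d dvd a" "d dvd b"
  then have "d\<^sup>2 dvd a * b" unfolding power2_eq_square by (rule mult_dvd_mono)
  then show "is_unit d" using assms squarefreeD by blast
qed

theorem theorem5p2: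
  fixes p q :: int
  assumes "p > 1" and "q > 1" and "p \<noteq> q"
    and "squarefree p" and "squarefree q"
  shows "\<not> (\<exists>r a. Z_form r a \<and> universal_over p q r a)"
proof
  assume "\<exists>r a. Z_form r a \<and> universal_over p q r a"
  then obtain r a where form: "Z_form r a" "universal_over p q r a" by blast
  define m where "m = gcd p q"
  have m: "m > 0" using assms(1) by (simp add: m_def)
  obtain k l where p: "p = m * k" and q: "q = m * l" and kl: "coprime k l"
    using gcd_coprime_exists[of p q] assms(1) unfolding m_def by (auto simp: mult.commute)
  have pos: "k > 0" "l > 0"
    using assms(1,2) m zero_less_mult_pos[of m k] zero_less_mult_pos[of m l] unfolding p q by simp_all
  have "squarefree k" "squarefree l"
    using assms(4,5) unfolding p q by (auto dest: squarefree_multD)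
  then have "squarefree (k * l)" using kl by (rule squarefree_mult_coprime[rotated])
  have ne: "k \<noteq> l" using assms(3) p q by auto
  \<comment> \<open>Squarefreeness makes m coprime to k and to l; equality would force the value 1
    and thus p = 1 or q = 1.\<close>
  have "m \<noteq> k" "m \<noteq> l"
    using squarefree_mult_imp_coprime[of m k] squarefree_mult_imp_coprime[of m l] assms m
    unfolding p q by auto
  have "k * l > 1"
    using mult_pos_pos[OF pos] pos ne pos_zmult_eq_1_iff[OF pos(1), of l] by linarith
  have "universal_form m k l p q (sqrt m) (sqrt k) (sqrt l) r a"
    using m pos assms \<open>squarefree (k * l)\<close> \<open>k * l > 1\<close> form biquad_field_eq_surd_field[OF m pos]
    unfolding p q by unfold_locales simp_all
  then show False
    using universal_form_False \<open>m \<noteq> k\<close> \<open>m \<noteq> l\<close> ne by blast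
qed

end
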